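(* Let $a:[0,\infty)\to\mathbb{R}$ be continuous with $a(t)>0$ for all $t\ge 0$ and $\int_0^\infty \frac{1}{a(t)}\,dt<\infty$. Let $b:[0,\infty)\to\mathbb{R}$ be continuous, nonnegative and not identically zero on $[0,1]$ (with no sign restriction for $t>1$), and let $B>0$ be a constant such that $b(t)\le B$ for all $t\in[1,\infty)$. Let $F:\mathbb{R}\to\mathbb{R}$ be continuous with $F(u)u>0$ for $u\ne 0$, differentiable on $[0,\infty)$ with $0\le \frac{dF(u)}{du}\le 1$ for $u\ge 0$, and such that $$\lim_{u\to 0^+}\frac{F(u)}{u}=k_0,\qquad \lim_{u\to\infty}\frac{F(u)}{u}=k_\infty,\qquad 0\le k_0\ne k_\infty .$$ Put $A(t)=\int_0^t\frac{1}{a(s)}\,ds$ and $|b|_L=\int_0^1|b(t)|\,dt$. Assume that the linear differential equation $$v''+\frac{B}{a(t)}v=0$$ is disconjugate on $[1,\infty)$, and that there exist $t_1,t_2\in(0,1)$, $t_1<t_2$, such that $\int_{t_1}^{t_2}b(t)\,dt>0$ and $$0\le \min\{k_0,k_\infty\}\,A(1)\,|b|_L<1,$$ $$\max\{k_0,k_\infty\}\int_{t_1}^{t_2}b(t)\,dt>\frac{A(1)}{A(t_1)\,(A(1)-A(t_2))}.$$ Then the boundary value problem $$(a(t)x')'+b(t)F(x)=0,\quad t\ge 0,$$ $$x(0)=0,\qquad x(t)>0 \text{ on }(0,\infty),\qquad \lim_{t\to\infty}x(t)=0$$ has a solution $x$. Moreover, this solution $x$ has a local maximum in the interval $(0,1]$,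 is decreasing on $[1,\infty)$, and satisfies $$\int_1^\infty\frac{1}{a(t)x^2(t)}\,dt=\infty .$$
   Context: A solution of $(a(t)x')'+b(t)F(x)=0$ on an interval is a $C^1$ function $x$ such that $a x'$ is $C^1$ and the equation holds at every point of the interval. A linear second order equation is said to be disconjugate on an interval $I$ if every nontrivial solution has at most one zero on $I$. Differentiability of $F$ on $[0,\infty)$ is understood one-sidedly at $u=0$. *)

theory Defs
  imports "HOL-Analysis.Analysis"
begin

(* x solves (p x')' + q f(x) = 0 on I: x is C^1 on I, p x' is C^1 on I (y' is its derivative), and
   the equation holds at every point of I. Derivatives are taken within I, so they are one-sided at
   endpoints of I, and only the values of p, q, x on I matter. *)
definition solution_on ::
  "(real \<Rightarrow> real) \<Rightarrow> (real \<Rightarrow> real) \<Rightarrow> (real \<Rightarrow> real) \<Rightarrow> real set \<Rightarrow> (real \<Rightarrow> real) \<Rightarrow> bool"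
  where "solution_on p q f I x \<longleftrightarrow>
    (\<exists>x' y'. (\<forall>t\<in>I. (x has_real_derivative x' t) (at t within I)) \<and> continuous_on I x' \<and>
       (\<forall>t\<in>I. ((\<lambda>s. p s * x' s) has_real_derivative y' t) (at t within I)) \<and> continuous_on I y' \<and>
       (\<forall>t\<in>I. y' t + q t * f (x t) = 0))"

(* Disconjugacy of the linear equation (p v')' + q v = 0 on I. *)
definition disconjugate_on :: "(real \<Rightarrow> real) \<Rightarrow> (real \<Rightarrow> real) \<Rightarrow> real set \<Rightarrow> bool"
  where "disconjugate_on p q I \<longleftrightarrow>
    (\<forall>v. solution_on p q (\<lambda>u. u) I v \<and> (\<exists>t\<in>I. v t \<noteq> 0) \<longrightarrow>
       (\<forall>s\<in>I. \<forall>t\<in>I. v s = 0 \<and> v t = 0 \<longrightarrow> s = t))"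

end

theory Submission imports Defs begin

text \<open>
With the flux z = a x' the equation becomes the first order system x' = z / a, z' = - b F(x). As only
positive solutions matter, F may be replaced by G(u) = F(max u 0), which is nondecreasing, Lipschitz
with constant 1 and satisfies 0 \<le> G(u) \<le> u for u \<ge> 0. Every initial value problem then has
exactly one solution on the whole half-line, and it depends continuously on the initial values. The
theorem is proved by shooting in the initial flux c = z(0) of the solution with x(0) = 0.

On [0, 1] the function b is nonnegative, so x is concave as a function of A. If
F(u) A(1) |b| < u for u = c A(1), the flux is still positive at 1; the limits of F(u)/u and the
smallness condition provide such a c (lemma \<open>increasing_phase\<close>). If x is positive on
(0, 1], the smaller one, m, of x(t1) and x(t2) satisfies F(m) \<integral>b A(t1) (A(1) - A(t2)) < m A(1), and
m is comparable to c (lemmas \<open>green_bound\<close> and \<open>values_comparable_to_slope\<close>).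
The largeness condition forbids this when c is very small or very large, so for some c the solution
has a zero.

On [1, \<infinity>) the comparison equation is the linear equation (a p')' + B p = 0. It is reciprocal to
v'' + (B / a) v = 0: if v solves the latter, p = v' solves the former. Disconjugacy makes the solution v
with v(1) = 0, v'(1) = 1 positive and hence, being concave on a half-line, increasing; so y = v' is a
positive solution of the comparison equation with y(1) = 1, y'(1) = 0, and y decreases. Since
b G(x) \<le> B x, the Wronskian a (x' p - x p') is nondecreasing as long as x \<ge> 0. It follows that it is
nonpositive up to the first zero of x (lemma \<open>wronskian_nonpos_before_zero\<close>). In
particular a solution which is positive on (0, 1] with positive flux at 1 never vanishes after 0.

So some values c produce a positive solution and others a solution with a zero. The latter form an
open set, since a nontrivial solution that reaches zero changes sign. Hence there is a
critical value c which is not in this set but is a limit of points of it. The critical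
solution x is positive, and the inequality for the Wronskian passes to the limit and holds for x on
all of [1, \<infinity>), against every positive solution p of the comparison equation (lemma
\<open>critical_solution\<close>). Everything else follows from these inequalities. With p = y they
give x' < 0 on (1, \<infinity>). They also say that x / p is nonincreasing, so x \<le> C p for a principal solution p,
and the divergence of the integral of 1 / (a p^2) carries over to x (lemma
\<open>principal_if_wronskians_nonpos\<close>). Finally, a positive limit of x at infinity would make
the integral of 1 / (a x^2) finite because 1 / a is integrable.
\<close>

section \<open>Initial value problems on a half-line\<close>

lemma continuous_on_atLeastI:
  fixes f :: "real \<Rightarrow> 'a::topological_space"
  assumes "\<And>T. t0 \<le> T \<Longrightarrow> continuous_on {t0..T} f"
  shows "continuous_on {t0..} f"
  unfolding continuous_on_def
proof
  fix t assume "t \<in> {t0..}"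
  then have "(f \<longlongrightarrow> f t) (at t within {t0..t + 1})"
    using assms[of "t + 1"] by (auto simp: continuous_on_def)
  moreover have "at t within {t0..t + 1} = at t within {t0..}"
    by (rule at_within_nhd[of t "{..<t + 1}"]) auto
  ultimately show "(f \<longlongrightarrow> f t) (at t within {t0..})" by simp
qed

lemma integral_has_vector_derivative_atLeast:
  fixes f :: "real \<Rightarrow> 'a::banach"
  assumes f: "continuous_on {t0..} f" and t: "t0 \<le> t"
  shows "((\<lambda>s. integral {t0..s} f) has_vector_derivative f t) (at t within {t0..})"
proof -
  have "continuous_on {t0..t + 1} f"
    by (rule continuous_on_subset[OF f]) auto
  then have "((\<lambda>s. integral {t0..s} f) has_vector_derivative f t) (at t within {t0..t + 1})"
    using t by (intro integral_has_vector_derivative) auto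
  moreover have "at t within {t0..t + 1} = at t within {t0..}"
    by (rule at_within_nhd[of t "{..<t + 1}"]) auto
  ultimately show ?thesis by simp
qed

text \<open>
In the norm weighted by exp (- 2 L (t - t0)) the Picard map contracts by the factor 1 / 2 on an interval
of any length. This is why the iteration below converges on the whole half-line at once, without
continuing local solutions.
\<close>

lemma picard_contraction:
  fixes u v :: "real \<Rightarrow> 'a::banach" and f :: "real \<Rightarrow> 'a \<Rightarrow> 'a"
  assumes L: "0 < L" and M: "0 \<le> M"
    and lip: "\<And>s u v. s \<in> {t0..T} \<Longrightarrow> norm (f s u - f s v) \<le> L * norm (u - v)"
    and fu: "continuous_on {t0..T} (\<lambda>s. f s (u s))" and fv: "continuous_on {t0..T} (\<lambda>s. f s (v s))"
    and uv: "\<And>s. s \<in> {t0..T} \<Longrightarrow> norm (u s - v s) \<le> M * exp (2 * L * (s - t0))"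
    and t: "t \<in> {t0..T}"
  shows "norm (integral {t0..t} (\<lambda>s. f s (u s)) - integral {t0..t} (\<lambda>s. f s (v s)))
           \<le> M / 2 * exp (2 * L * (t - t0))"
proof -
  define E where "E = (\<lambda>s. M / 2 * exp (2 * L * (s - t0)))"
  have sub: "{t0..t} \<subseteq> {t0..T}" using t by auto
  have iu: "(\<lambda>s. f s (u s)) integrable_on {t0..t}" and iv: "(\<lambda>s. f s (v s)) integrable_on {t0..t}"
    using continuous_on_subset[OF fu sub] continuous_on_subset[OF fv sub]
    by (auto intro: integrable_continuous_real)
  have E: "((\<lambda>s. L * M * exp (2 * L * (s - t0))) has_integral (E t - E t0)) {t0..t}"
  proof (rule fundamental_theorem_of_calculus)
    show "t0 \<le> t" using t by auto
    show "(E has_vector_derivative L * M * exp (2 * L * (s - t0))) (at s within {t0..t})" for s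
      unfolding E_def has_real_derivative_iff_has_vector_derivative[symmetric]
      by (auto intro!: derivative_eq_intros)
  qed
  have "norm (integral {t0..t} (\<lambda>s. f s (u s) - f s (v s))) \<le> E t - E t0"
    unfolding integral_unique[OF E, symmetric]
  proof (rule integral_norm_bound_integral)
    show "(\<lambda>s. f s (u s) - f s (v s)) integrable_on {t0..t}" by (intro integrable_diff iu iv)
    show "(\<lambda>s. L * M * exp (2 * L * (s - t0))) integrable_on {t0..t}" using E by blast
    fix s assume "s \<in> {t0..t}"
    then have s: "s \<in> {t0..T}" using sub by auto
    have "norm (f s (u s) - f s (v s)) \<le> L * norm (u s - v s)" by (rule lip[OF s])
    also have "\<dots> \<le> L * (M * exp (2 * L * (s - t0)))"
      using L uv[OF s] by (intro mult_left_mono) auto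
    finally show "norm (f s (u s) - f s (v s)) \<le> L * M * exp (2 * L * (s - t0))" by (simp add: mult.assoc)
  qed
  moreover have "0 \<le> E t0" using M by (simp add: E_def)
  ultimately show ?thesis
    by (simp add: integral_diff[OF iu iv] E_def)
qed

text \<open>
The Picard iterates are defined on all of [t0, \<infinity>) and converge uniformly on every compact interval; the
Lipschitz constant may grow with the interval because it only enters the rate of convergence there.
\<close>

theorem picard_lindeloef_half_line:
  fixes f :: "real \<Rightarrow> 'a::banach \<Rightarrow> 'a"
  assumes cont: "continuous_on ({t0..} \<times> UNIV) (\<lambda>(t, u). f t u)"
    and lip: "\<And>T. \<exists>L. \<forall>t\<in>{t0..T}. \<forall>u v. norm (f t u - f t v) \<le> L * norm (u - v)"
  obtains u where "u t0 = u0"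
    and "\<And>t. t0 \<le> t \<Longrightarrow> (u has_vector_derivative f t (u t)) (at t within {t0..})"
proof -
  define U where "U = rec_nat (\<lambda>_. u0) (\<lambda>_ w t. u0 + integral {t0..t} (\<lambda>s. f s (w s)))"
  have U_0: "U 0 = (\<lambda>_. u0)"
    and U_Suc: "U (Suc n) = (\<lambda>t. u0 + integral {t0..t} (\<lambda>s. f s (U n s)))" for n
    by (simp_all add: U_def)
  have cont_f: "continuous_on {t0..} (\<lambda>t. f t (w t))" if "continuous_on {t0..} w" for w
  proof -
    have "continuous_on {t0..} ((\<lambda>(t, u). f t u) \<circ> (\<lambda>t. (t, w t)))"
      by (intro continuous_on_compose continuous_on_subset[OF cont] continuous_intros that) auto
    then show ?thesis by (simp add: o_def)
  qed
  have cont_int: "continuous_on {t0..} (\<lambda>t. integral {t0..t} w)" if "continuous_on {t0..} w" for w :: "real \<Rightarrow> 'a"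
    using has_vector_derivative_continuous[OF integral_has_vector_derivative_atLeast[OF that]]
    by (auto simp: continuous_on_eq_continuous_within)
  have U_cont: "continuous_on {t0..} (U n)" for n
  proof (induction n)
    case (Suc n)
    show ?case unfolding U_Suc by (intro continuous_intros cont_int cont_f Suc)
  qed (simp add: U_0)
  define u where "u = (\<lambda>t. u0 + (\<Sum>n. U (Suc n) t - U n t))"
  have unif: "uniform_limit {t0..T} U u sequentially \<and>
       (\<forall>t\<in>{t0..T}. u t = u0 + integral {t0..t} (\<lambda>s. f s (u s)))" if T: "t0 \<le> T" for T
  proof -
    obtain L0 where L0: "\<And>s u v. s \<in> {t0..T} \<Longrightarrow> norm (f s u - f s v) \<le> L0 * norm (u - v)"
      using lip[of T] by blast
    \<comment> \<open>The contraction needs a positive constant, and L0 need not be positive.\<close>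
    define L where "L = max L0 1"
    have L: "0 < L" by (simp add: L_def)
    have lipL: "norm (f s u - f s v) \<le> L * norm (u - v)" if "s \<in> {t0..T}" for s u v
      by (rule order_trans[OF L0[OF that]]) (auto simp: L_def intro: mult_right_mono)
    have fU_cont: "continuous_on {t0..T} (\<lambda>s. f s (U n s))" for n
      by (rule continuous_on_subset[OF cont_f[OF U_cont]]) auto
    have "compact ((\<lambda>t. U 1 t - U 0 t) ` {t0..T})"
      by (intro compact_continuous_image continuous_intros continuous_on_subset[OF U_cont]) auto
    then obtain M where M: "\<And>t. t \<in> {t0..T} \<Longrightarrow> norm (U 1 t - U 0 t) \<le> M"
      using compact_imp_bounded bounded_iff by (metis (no_types, lifting) imageI)
    have M0: "0 \<le> M" using M[of t0] T by (auto intro: order_trans[OF norm_ge_zero])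
    have diff: "norm (U (Suc n) t - U n t) \<le> M / 2 ^ n * exp (2 * L * (t - t0))" if "t \<in> {t0..T}" for n t
      using that
    proof (induction n arbitrary: t)
      case 0
      have "M * 1 \<le> M * exp (2 * L * (t - t0))"
        using 0 L M0 by (intro mult_left_mono) auto
      then show ?case using M[OF 0] by simp
    next
      case (Suc n)
      have "norm (integral {t0..t} (\<lambda>s. f s (U (Suc n) s)) - integral {t0..t} (\<lambda>s. f s (U n s)))
           \<le> M / 2 ^ n / 2 * exp (2 * L * (t - t0))"
        by (rule picard_contraction[OF L _ lipL fU_cont fU_cont Suc.IH Suc.prems]) (use M0 in auto)
      then show ?case by (simp add: U_Suc field_simps)
    qed
    have "uniform_limit {t0..T} (\<lambda>n t. \<Sum>i<n. U (Suc i) t - U i t) (\<lambda>t. \<Sum>i. U (Suc i) t - U i t) sequentially"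
    proof (rule Weierstrass_m_test)
      fix n t assume t: "t \<in> {t0..T}"
      have "M / 2 ^ n * exp (2 * L * (t - t0)) \<le> M / 2 ^ n * exp (2 * L * (T - t0))"
        using M0 L t by (intro mult_left_mono) auto
      with diff[OF t, of n]
      show "norm (U (Suc n) t - U n t) \<le> M * exp (2 * L * (T - t0)) * (1 / 2) ^ n"
        by (simp add: power_divide mult.commute mult.left_commute)
    next
      show "summable (\<lambda>n. M * exp (2 * L * (T - t0)) * (1 / 2) ^ n)"
        by (intro summable_mult summable_geometric) auto
    qed
    moreover have "(\<Sum>i<n. U (Suc i) t - U i t) = U n t - u0" for n t
      using sum_lessThan_telescope[of "\<lambda>n. U n t" n] by (simp add: U_0)
    ultimately have "uniform_limit {t0..T} (\<lambda>n t. U n t - u0) (\<lambda>t. \<Sum>i. U (Suc i) t - U i t) sequentially"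
      by simp
    then have lim: "uniform_limit {t0..T} U u sequentially"
      unfolding uniform_limit_iff u_def dist_norm by (simp add: algebra_simps)
    have limf: "uniform_limit {t0..T} (\<lambda>n s. f s (U n s)) (\<lambda>s. f s (u s)) sequentially"
    proof (rule uniform_limitI)
      fix e :: real assume "0 < e"
      then have "\<forall>\<^sub>F n in sequentially. \<forall>s\<in>{t0..T}. dist (U n s) (u s) < e / L"
        using lim L by (intro uniform_limitD) auto
      then show "\<forall>\<^sub>F n in sequentially. \<forall>s\<in>{t0..T}. dist (f s (U n s)) (f s (u s)) < e"
      proof eventually_elim
        case (elim n)
        show ?case
        proof
          fix s assume s: "s \<in> {t0..T}"
          have "dist (f s (U n s)) (f s (u s)) \<le> L * dist (U n s) (u s)"
            using lipL[OF s] by (simp add: dist_norm)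
          also have "\<dots> < L * (e / L)" using L elim s by (intro mult_strict_left_mono) auto
          finally show "dist (f s (U n s)) (f s (u s)) < e" using L by simp
        qed
      qed
    qed
    have "u t = u0 + integral {t0..t} (\<lambda>s. f s (u s))" if t: "t \<in> {t0..T}" for t
    proof (rule LIMSEQ_unique)
      have "(\<lambda>n. U n t) \<longlonglongrightarrow> u t" by (rule tendsto_uniform_limitI[OF lim t])
      then show "(\<lambda>n. U (Suc n) t) \<longlonglongrightarrow> u t" by (rule LIMSEQ_Suc)
      have limt: "uniform_limit {t0..t} (\<lambda>n s. f s (U n s)) (\<lambda>s. f s (u s)) sequentially"
        by (rule uniform_limit_on_subset[OF limf]) (use t in auto)
      obtain I J where I: "\<And>n. ((\<lambda>s. f s (U n s)) has_integral I n) {t0..t}"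
        and J: "((\<lambda>s. f s (u s)) has_integral J) {t0..t}" and IJ: "I \<longlonglongrightarrow> J"
        using uniform_limit_integral[OF limt] continuous_on_subset[OF fU_cont, of "{t0..t}"] t
        by (metis atLeastatMost_subset_iff atLeastAtMost_iff order_refl sequentially_bot)
      show "(\<lambda>n. U (Suc n) t) \<longlonglongrightarrow> u0 + integral {t0..t} (\<lambda>s. f s (u s))"
        unfolding U_Suc integral_unique[OF I] integral_unique[OF J] by (intro tendsto_intros IJ)
    qed
    with lim show ?thesis by blast
  qed
  have u_cont: "continuous_on {t0..} u"
  proof (rule continuous_on_atLeastI)
    fix T assume T: "t0 \<le> T"
    show "continuous_on {t0..T} u"
      by (rule uniform_limit_theorem[OF _ conjunct1[OF unif[OF T]]])
        (auto intro!: always_eventually continuous_on_subset[OF U_cont])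
  qed
  have fix_u: "u t = u0 + integral {t0..t} (\<lambda>s. f s (u s))" if "t0 \<le> t" for t
    using unif[OF that] that by auto
  show thesis
  proof (rule that)
    show "u t0 = u0" using fix_u[of t0] by simp
    fix t assume t: "t0 \<le> t"
    have "((\<lambda>t. u0 + integral {t0..t} (\<lambda>s. f s (u s))) has_vector_derivative f t (u t)) (at t within {t0..})"
      using integral_has_vector_derivative_atLeast[OF cont_f[OF u_cont] t]
      by (auto intro!: derivative_eq_intros)
    then show "(u has_vector_derivative f t (u t)) (at t within {t0..})"
      by (rule has_vector_derivative_transform[rotated 2]) (use t fix_u in auto)
  qed
qed

section \<open>Sturm--Liouville systems\<close>

lemma half_line_derivative_at:
  fixes f :: "real \<Rightarrow> real"
  assumes "(f has_real_derivative D) (at t within {t0..})" and "t0 < t"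
  shows "(f has_real_derivative D) (at t)"
  using assms at_within_interior[of t "{t0..}"] by simp

lemma half_line_derivative_nondecreasing:
  fixes f :: "real \<Rightarrow> real"
  assumes D: "\<And>t. t0 \<le> t \<Longrightarrow> (f has_real_derivative f' t) (at t within {t0..})"
    and "t0 \<le> s" "s \<le> t" and nonneg: "\<And>r. s < r \<Longrightarrow> r < t \<Longrightarrow> 0 \<le> f' r"
  shows "f s \<le> f t"
proof (rule DERIV_nonneg_imp_increasing_open[OF \<open>s \<le> t\<close>])
  show "\<exists>y. DERIV f r :> y \<and> y \<ge> 0" if "s < r" "r < t" for r
    using half_line_derivative_at[OF D[of r]] nonneg that assms(2) by fastforce
  show "continuous_on {s..t} f"
    by (rule DERIV_continuous_on[of _ _ f'], rule DERIV_subset[OF D]) (use assms(2) in auto)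
qed

lemma half_line_derivative_increasing:
  fixes f :: "real \<Rightarrow> real"
  assumes D: "\<And>t. t0 \<le> t \<Longrightarrow> (f has_real_derivative f' t) (at t within {t0..})"
    and "t0 \<le> s" "s < t" and pos: "\<And>r. s < r \<Longrightarrow> r < t \<Longrightarrow> 0 < f' r"
  shows "f s < f t"
proof (rule DERIV_pos_imp_increasing_open[OF \<open>s < t\<close>])
  show "\<exists>y. DERIV f r :> y \<and> y > 0" if "s < r" "r < t" for r
    using half_line_derivative_at[OF D[of r]] pos that assms(2) by fastforce
  show "continuous_on {s..t} f"
    by (rule DERIV_continuous_on[of _ _ f'], rule DERIV_subset[OF D]) (use assms(2) in auto)
qed

text \<open>
The flux z = a x' is carried along as a second function, so that no derivative of a is needed and the
Wronskian is a polynomial in the functions of the systems.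
\<close>

definition sl_system ::
  "(real \<Rightarrow> real) \<Rightarrow> (real \<Rightarrow> real) \<Rightarrow> (real \<Rightarrow> real) \<Rightarrow> real \<Rightarrow> (real \<Rightarrow> real) \<Rightarrow> (real \<Rightarrow> real) \<Rightarrow> bool"
  where "sl_system a b G t0 x z \<longleftrightarrow>
    (\<forall>t\<ge>t0. (x has_real_derivative z t / a t) (at t within {t0..}) \<and>
       (z has_real_derivative - b t * G (x t)) (at t within {t0..}))"

lemma sl_systemD:
  assumes "sl_system a b G t0 x z" and "t0 \<le> t"
  shows "(x has_real_derivative z t / a t) (at t within {t0..})"
    and "(z has_real_derivative - b t * G (x t)) (at t within {t0..})"
  using assms by (auto simp: sl_system_def)

lemma sl_system_continuous:
  assumes "sl_system a b G t0 x z"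
  shows "continuous_on {t0..} x" and "continuous_on {t0..} z"
  by (rule DERIV_continuous_on, use sl_systemD[OF assms] in blast)+

lemma sl_system_later:
  assumes "sl_system a b G t0 x z" and "t0 \<le> t1"
  shows "sl_system a b G t1 x z"
  unfolding sl_system_def
proof (intro allI impI conjI)
  fix t assume "t1 \<le> t"
  then have "t0 \<le> t" "{t1..} \<subseteq> {t0..}" using assms(2) by auto
  then show "(x has_real_derivative z t / a t) (at t within {t1..})"
    and "(z has_real_derivative - b t * G (x t)) (at t within {t1..})"
    using DERIV_subset[OF sl_systemD(1)[OF assms(1)]] DERIV_subset[OF sl_systemD(2)[OF assms(1)]]
    by blast+
qed

lemma sl_system_coefficient_bound:
  fixes a b :: "real \<Rightarrow> real"
  assumes "continuous_on {t0..} a" "\<And>t. t0 \<le> t \<Longrightarrow> 0 < a t" "continuous_on {t0..} b"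
  obtains K where "\<And>t. t \<in> {t0..T} \<Longrightarrow> 1 / a t + \<bar>b t\<bar> \<le> K"
proof -
  have "compact ((\<lambda>t. 1 / a t + \<bar>b t\<bar>) ` {t0..T})"
    using assms
    by (intro compact_continuous_image continuous_intros continuous_on_subset[OF assms(1)]
        continuous_on_subset[OF assms(3)]) (auto simp: less_imp_neq[symmetric])
  then obtain K where "\<And>t. t \<in> {t0..T} \<Longrightarrow> norm (1 / a t + \<bar>b t\<bar>) \<le> K"
    using compact_imp_bounded bounded_iff by (metis (no_types, lifting) imageI)
  then show thesis by (intro that[of K]) (auto intro: order_trans[OF abs_ge_self])
qed

lemma sl_system_exists:
  assumes a: "continuous_on {t0..} a" "\<And>t. t0 \<le> t \<Longrightarrow> 0 < a t" and b: "continuous_on {t0..} b"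
    and G: "\<And>u v :: real. \<bar>G u - G v\<bar> \<le> \<bar>u - v\<bar>"
  obtains x z where "sl_system a b G t0 x z" "x t0 = c" "z t0 = m"
proof -
  define f where "f = (\<lambda>t (u :: real \<times> real). (snd u / a t, - b t * G (fst u)))"
  have "continuous_on UNIV G"
    by (rule lipschitz_on_continuous_on[of 1]) (auto simp: lipschitz_on_def dist_real_def G)
  have cont: "continuous_on ({t0..} \<times> UNIV) (\<lambda>(t, u). f t u)"
    unfolding f_def case_prod_beta
    by (intro continuous_intros continuous_on_compose2[OF a(1)] continuous_on_compose2[OF b]
        continuous_on_compose2[OF \<open>continuous_on UNIV G\<close>])
      (use a(2) in \<open>auto simp: less_imp_neq[symmetric]\<close>)
  have lip: "\<exists>L. \<forall>t\<in>{t0..T}. \<forall>u v. norm (f t u - f t v) \<le> L * norm (u - v)" for T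
  proof -
    obtain K where K: "\<And>t. t \<in> {t0..T} \<Longrightarrow> 1 / a t + \<bar>b t\<bar> \<le> K"
      using sl_system_coefficient_bound[OF a b] by blast
    have "norm (f t u - f t v) \<le> K * norm (u - v)" if t: "t \<in> {t0..T}" for t u v
    proof -
      have "norm (f t u - f t v) \<le> norm ((snd u - snd v) / a t) + norm (b t * (G (fst u) - G (fst v)))"
        using norm_Pair_le[of "(snd u - snd v) / a t" "- b t * (G (fst u) - G (fst v))"]
        by (simp add: f_def diff_divide_distrib algebra_simps)
      also have "\<dots> \<le> 1 / a t * norm (u - v) + \<bar>b t\<bar> * norm (u - v)"
      proof (rule add_mono)
        have "\<bar>snd u - snd v\<bar> \<le> norm (u - v)"
          using norm_snd_le[of "snd (u - v)" "fst (u - v)"] unfolding prod.collapse by simp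
        then show "norm ((snd u - snd v) / a t) \<le> 1 / a t * norm (u - v)"
          using a(2)[of t] t by (auto simp: abs_div_pos[symmetric] divide_right_mono)
        have "\<bar>G (fst u) - G (fst v)\<bar> \<le> norm (u - v)"
          using G[of "fst u" "fst v"] norm_fst_le[of "fst (u - v)" "snd (u - v)"]
          unfolding prod.collapse by simp
        then show "norm (b t * (G (fst u) - G (fst v))) \<le> \<bar>b t\<bar> * norm (u - v)"
          by (auto simp: abs_mult mult_left_mono)
      qed
      also have "\<dots> = (1 / a t + \<bar>b t\<bar>) * norm (u - v)" by (simp add: algebra_simps)
      also have "\<dots> \<le> K * norm (u - v)" by (intro mult_right_mono K t) auto
      finally show ?thesis .
    qed
    then show ?thesis by blast
  qed
  obtain u where u0: "u t0 = (c, m)"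
    and u: "\<And>t. t0 \<le> t \<Longrightarrow> (u has_vector_derivative f t (u t)) (at t within {t0..})"
    using picard_lindeloef_half_line[OF cont lip, of "(c, m)"] by metis
  show thesis
  proof (rule that)
    show "sl_system a b G t0 (\<lambda>t. fst (u t)) (\<lambda>t. snd (u t))"
      unfolding sl_system_def has_real_derivative_iff_has_vector_derivative
      using bounded_linear.has_vector_derivative[OF bounded_linear_fst u]
        bounded_linear.has_vector_derivative[OF bounded_linear_snd u]
      by (auto simp: f_def)
  qed (simp_all add: u0)
qed

text \<open>
Gronwall's argument for the squared distance of two solutions. The derivative of this distance is
bounded on both sides, so the estimate also runs backwards in time; this gives uniqueness from a
later point, used to exclude double zeros.
\<close>

lemma sl_system_dependence:
  assumes s1: "sl_system a b G t0 x1 z1" and s2: "sl_system a b G t0 x2 z2"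
    and a: "\<And>t. t0 \<le> t \<Longrightarrow> 0 < a t"
    and G: "\<And>u v :: real. \<bar>G u - G v\<bar> \<le> \<bar>u - v\<bar>"
    and K: "\<And>t. t \<in> {t0..T} \<Longrightarrow> 1 / a t + \<bar>b t\<bar> \<le> K"
    and st: "s \<in> {t0..T}" "t \<in> {t0..T}"
  shows "(x1 t - x2 t)\<^sup>2 + (z1 t - z2 t)\<^sup>2
           \<le> ((x1 s - x2 s)\<^sup>2 + (z1 s - z2 s)\<^sup>2) * exp (K * \<bar>t - s\<bar>)"
proof -
  define D where "D = (\<lambda>t. (x1 t - x2 t)\<^sup>2 + (z1 t - z2 t)\<^sup>2)"
  define D' where "D' = (\<lambda>t. 2 * (x1 t - x2 t) * (z1 t - z2 t) / a t
      - 2 * b t * (z1 t - z2 t) * (G (x1 t) - G (x2 t)))"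
  have D: "(D has_real_derivative D' t) (at t within {t0..})" if "t0 \<le> t" for t
    unfolding D_def D'_def using a[OF that]
    by (auto intro!: derivative_eq_intros sl_systemD[OF s1 that] sl_systemD[OF s2 that] simp: field_simps)
  have bound: "\<bar>D' t\<bar> \<le> K * D t" if t: "t \<in> {t0..T}" for t
  proof -
    let ?X = "\<bar>x1 t - x2 t\<bar>" and ?Z = "\<bar>z1 t - z2 t\<bar>"
    have "\<bar>D' t\<bar> \<le> \<bar>2 * (x1 t - x2 t) * (z1 t - z2 t) / a t\<bar>
        + \<bar>2 * b t * (z1 t - z2 t) * (G (x1 t) - G (x2 t))\<bar>"
      unfolding D'_def by (rule abs_triangle_ineq4)
    also have "\<dots> = (2 * ?X * ?Z) * (1 / a t) + (2 * \<bar>G (x1 t) - G (x2 t)\<bar> * ?Z) * \<bar>b t\<bar>"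
      using a[of t] t by (simp add: abs_mult del: right_diff_distrib_numeral)
    also have "\<dots> \<le> (2 * ?X * ?Z) * (1 / a t) + (2 * ?X * ?Z) * \<bar>b t\<bar>"
      by (intro add_left_mono mult_right_mono mult_left_mono G) auto
    also have "\<dots> = (1 / a t + \<bar>b t\<bar>) * (2 * ?X * ?Z)" by (simp add: algebra_simps)
    also have "\<dots> \<le> K * (2 * ?X * ?Z)" by (intro mult_right_mono K t) auto
    also have "\<dots> \<le> K * D t"
    proof (rule mult_left_mono)
      show "2 * ?X * ?Z \<le> D t"
        using sum_squares_bound[of ?X ?Z] by (simp add: D_def)
      have "0 < 1 / a t" using a[of t] t by simp
      then show "0 \<le> K" using K[OF t] by linarith
    qed
    finally show ?thesis .
  qed
  have "D t \<le> D s * exp (K * \<bar>t - s\<bar>)"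
  proof (cases "s \<le> t")
    case True
    have "- (D s * exp (- (K * s))) \<le> - (D t * exp (- (K * t)))"
    proof (rule half_line_derivative_nondecreasing[where f = "\<lambda>r. - (D r * exp (- (K * r)))"])
      show "((\<lambda>r. - (D r * exp (- (K * r)))) has_real_derivative (K * D r - D' r) * exp (- (K * r)))
          (at r within {t0..})" if "t0 \<le> r" for r
        by (auto intro!: derivative_eq_intros D that simp: algebra_simps)
      show "0 \<le> (K * D r - D' r) * exp (- (K * r))" if "s < r" "r < t" for r
        using bound[of r] that st by auto
    qed (use st True in auto)
    then have "D t * exp (- (K * t)) * exp (K * t) \<le> D s * exp (- (K * s)) * exp (K * t)"
      by (intro mult_right_mono) auto
    then show ?thesis using True by (simp add: mult.assoc exp_add[symmetric] algebra_simps)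
  next
    case False
    have "D t * exp (K * t) \<le> D s * exp (K * s)"
    proof (rule half_line_derivative_nondecreasing[where f = "\<lambda>r. D r * exp (K * r)"])
      show "((\<lambda>r. D r * exp (K * r)) has_real_derivative (K * D r + D' r) * exp (K * r))
          (at r within {t0..})" if "t0 \<le> r" for r
        by (auto intro!: derivative_eq_intros D that simp: algebra_simps)
      show "0 \<le> (K * D r + D' r) * exp (K * r)" if "t < r" "r < s" for r
        using bound[of r] that st by auto
    qed (use st False in auto)
    then have "D t * exp (K * t) * exp (- (K * t)) \<le> D s * exp (K * s) * exp (- (K * t))"
      by (intro mult_right_mono) auto
    then show ?thesis using False by (simp add: mult.assoc exp_add[symmetric] algebra_simps)
  qed
  then show ?thesis by (simp add: D_def)
qed

section \<open>Comparison with the linear majorant\<close>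

lemma first_zero:
  fixes x :: "real \<Rightarrow> real"
  assumes cont: "continuous_on {t0..} x" and "0 < x t0" "t0 \<le> t" "x t \<le> 0"
  obtains T where "t0 < T" "x T = 0" "\<And>s. t0 \<le> s \<Longrightarrow> s < T \<Longrightarrow> 0 < x s"
proof -
  let ?Z = "{t0..t} \<inter> x -` {..0}"
  have cont_t: "continuous_on {t0..s} x" for s
    by (rule continuous_on_subset[OF cont]) auto
  have "closed ?Z" by (intro continuous_closed_preimage cont_t) auto
  then have "compact ?Z"
    by (metis bounded_Int bounded_closed_interval compact_eq_bounded_closed)
  moreover have "t \<in> ?Z" using assms by auto
  ultimately obtain T where T: "T \<in> ?Z" and least: "\<And>s. s \<in> ?Z \<Longrightarrow> T \<le> s"
    using compact_attains_inf[of ?Z] by blast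
  have pos: "0 < x s" if "t0 \<le> s" "s < T" for s
    using least[of s] that T by force
  have "t0 < T" using T \<open>0 < x t0\<close> by (cases "T = t0") auto
  moreover have "x T = 0"
  proof -
    obtain s where s: "t0 \<le> s" "s \<le> T" "x s = 0"
      using IVT2'[of x T 0 t0] T \<open>0 < x t0\<close> cont_t[of T] by auto
    then show ?thesis using pos[of s] by (cases "s = T") auto
  qed
  ultimately show thesis using pos that by blast
qed

text \<open>
The mixed terms cancel because both fluxes belong to the same coefficient a; the Wronskian is driven
only by the excess of the linear term B x over b G(x).
\<close>

lemma wronskian_derivative:
  assumes x: "sl_system a b G t0 x z" and p: "sl_system a (\<lambda>_. B) (\<lambda>u. u) t0 p q" and "t0 \<le> t"
  shows "((\<lambda>t. z t * p t - x t * q t) has_real_derivative p t * (B * x t - b t * G (x t)))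
           (at t within {t0..})"
  by (auto intro!: derivative_eq_intros sl_systemD[OF x \<open>t0 \<le> t\<close>] sl_systemD[OF p \<open>t0 \<le> t\<close>]
      simp: algebra_simps)

text \<open>
At the zero T the flux of x cannot be positive and the second term of the Wronskian vanishes, so the
Wronskian is nonpositive there. Up to T it is nondecreasing, whatever the sign of b, because
b G(x) \<le> B G(x) \<le> B x. This is Sturm comparison read backwards from T.
\<close>

lemma wronskian_nonpos_before_zero:
  assumes x: "sl_system a b G t0 x z" and p: "sl_system a (\<lambda>_. B) (\<lambda>u. u) t0 p q"
    and a: "\<And>t. t0 \<le> t \<Longrightarrow> 0 < a t" and p_pos: "\<And>t. t0 \<le> t \<Longrightarrow> 0 < p t"
    and B: "0 \<le> B" "\<And>t. t0 \<le> t \<Longrightarrow> b t \<le> B"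
    and G: "\<And>u :: real. 0 \<le> u \<Longrightarrow> 0 \<le> G u \<and> G u \<le> u"
    and T: "t0 < T" "x T = 0" and nonneg: "\<And>t. t0 \<le> t \<Longrightarrow> t < T \<Longrightarrow> 0 \<le> x t"
    and s: "t0 \<le> s" "s \<le> T"
  shows "z s * p s - x s * q s \<le> 0"
proof -
  have "z s * p s - x s * q s \<le> z T * p T - x T * q T"
  proof (rule half_line_derivative_nondecreasing[where f = "\<lambda>t. z t * p t - x t * q t",
        OF wronskian_derivative[OF x p]])
    fix r assume "s < r" "r < T"
    then have r: "t0 \<le> r" "0 \<le> x r" using nonneg[of r] s by auto
    have "b r * G (x r) \<le> B * G (x r)" using B G r by (intro mult_right_mono) auto
    also have "\<dots> \<le> B * x r" using B G r by (intro mult_left_mono) auto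
    finally show "0 \<le> p r * (B * x r - b r * G (x r))" using p_pos[of r] r by simp
  qed (use s in auto)
  moreover have "z T \<le> 0"
  proof (rule ccontr)
    assume "\<not> z T \<le> 0"
    then have "0 < z T / a T" using a[of T] T by simp
    moreover have "DERIV x T :> z T / a T"
      using half_line_derivative_at[OF sl_systemD(1)[OF x]] T by simp
    ultimately obtain d where d: "0 < d" "\<And>h. 0 < h \<Longrightarrow> h < d \<Longrightarrow> x (T - h) < x T"
      using DERIV_pos_inc_left by blast
    define h where "h = min (d / 2) (T - t0)"
    have "0 < h" "h < d" "t0 \<le> T - h" "T - h < T" using d(1) T by (auto simp: h_def)
    then show False using d(2)[of h] nonneg[of "T - h"] T by auto
  qed
  then have "z T * p T \<le> 0" using p_pos[of T] T by (simp add: mult_le_0_iff)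
  ultimately show ?thesis using T by simp
qed

text \<open>
The reciprocity between v'' + (B / a) v = 0 and (a y')' + B y = 0: if y solves the second equation with
flux w, then v = - w / B solves the first one with v' = y. For the solution with w(t0) = 0 disconjugacy excludes
further zeros of w. If y became nonpositive, w would be driven linearly upwards and become positive.
\<close>

lemma disconjugate_positive_reciprocal:
  assumes a: "continuous_on {t0..} a" "\<And>t. t0 \<le> t \<Longrightarrow> 0 < a t" and B: "0 < B"
    and disc: "disconjugate_on (\<lambda>t. 1) (\<lambda>t. B / a t) {t0..}"
  obtains y w where "sl_system a (\<lambda>_. B) (\<lambda>u. u) t0 y w" "y t0 = 1" "w t0 = 0"
    and "\<And>t. t0 \<le> t \<Longrightarrow> 0 < y t" "\<And>t. t0 < t \<Longrightarrow> w t < 0"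
proof -
  obtain y w where yw: "sl_system a (\<lambda>_. B) (\<lambda>u. u) t0 y w" and y0: "y t0 = 1" and w0: "w t0 = 0"
    by (rule sl_system_exists[OF a, of "\<lambda>_. B" "\<lambda>u. u" 1 0]) (auto intro!: continuous_intros)
  note Dy = sl_systemD(1)[OF yw] and Dw = sl_systemD(2)[OF yw]
  have w_cont: "continuous_on {r..s} w" if "t0 \<le> r" for r s
    by (rule continuous_on_subset[OF sl_system_continuous(2)[OF yw]]) (use that in auto)
  have Dneg: "((\<lambda>t. - w t) has_real_derivative B * y t) (at t within {t0..})" if "t0 \<le> t" for t
    using DERIV_minus[OF Dw[OF that]] by simp
  have neg_somewhere: "\<exists>r. t0 < r \<and> r \<le> s \<and> w r < 0" if s: "t0 < s" for s
  proof (rule ccontr)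
    assume "\<not> ?thesis"
    then have w: "0 \<le> w r" if "t0 < r" "r \<le> s" for r using that by force
    have y: "y t0 \<le> y r" if r: "t0 \<le> r" "r \<le> s" for r
    proof (rule half_line_derivative_nondecreasing[OF Dy])
      show "0 \<le> w u / a u" if "t0 < u" "u < r" for u
        using w[of u] a(2)[of u] r that by auto
    qed (use r in auto)
    have "- w t0 < - w s"
    proof (rule half_line_derivative_increasing[where f = "\<lambda>t. - w t", OF Dneg])
      show "0 < B * y r" if "t0 < r" "r < s" for r
        using y[of r] B y0 that by auto
    qed (use s in auto)
    then show False using w[of s] s w0 by simp
  qed
  have sol: "solution_on (\<lambda>t. 1) (\<lambda>t. B / a t) (\<lambda>u. u) {t0..} (\<lambda>t. - w t / B)"
    unfolding solution_on_def
  proof (rule exI[of _ y], rule exI[of _ "\<lambda>t. w t / a t"], intro conjI ballI)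
    fix t assume t: "t \<in> {t0..}"
    show "((\<lambda>t. - w t / B) has_real_derivative y t) (at t within {t0..})"
      using DERIV_cdivide[OF Dneg, of t B] t B by simp
    show "((\<lambda>s. 1 * y s) has_real_derivative w t / a t) (at t within {t0..})"
      using Dy[of t] t by simp
    show "w t / a t + B / a t * (- w t / B) = 0" using B by simp
  next
    show "continuous_on {t0..} y" by (rule sl_system_continuous[OF yw])
    show "continuous_on {t0..} (\<lambda>t. w t / a t)"
      by (intro continuous_intros a sl_system_continuous[OF yw]) (auto dest: a(2))
  qed
  have w_nz: "w t \<noteq> 0" if t: "t0 < t" for t
  proof
    assume "w t = 0"
    moreover obtain r where r: "t0 < r" "w r < 0" using neg_somewhere[OF t] by blast
    from r have "\<exists>r\<in>{t0..}. - w r / B \<noteq> 0" using B by (intro bexI[of _ r]) auto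
    ultimately have "t0 = t"
      using disc[unfolded disconjugate_on_def, rule_format, of "\<lambda>t. - w t / B" t0 t] sol t w0
      by simp
    with t show False by simp
  qed
  have w_neg: "w t < 0" if t: "t0 < t" for t
  proof (rule ccontr)
    assume "\<not> w t < 0"
    obtain r where r: "t0 < r" "r \<le> t" "w r < 0" using neg_somewhere[OF t] by blast
    then obtain s where "r \<le> s" "w s = 0"
      using IVT'[of w r 0 t] \<open>\<not> w t < 0\<close> w_cont[of r t] by auto
    then show False using w_nz[of s] r by simp
  qed
  have Dny: "((\<lambda>t. - y t) has_real_derivative - w t / a t) (at t within {t0..})" if "t0 \<le> t" for t
    using DERIV_minus[OF Dy[OF that]] by simp
  have y_decr: "y t < y s" if st: "t0 \<le> s" "s < t" for s t
  proof -
    have "- y s < - y t"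
    proof (rule half_line_derivative_increasing[where f = "\<lambda>t. - y t", OF Dny])
      show "0 < - w r / a r" if "s < r" "r < t" for r
        using w_neg[of r] a(2)[of r] st that by (auto simp: field_simps)
    qed (use st in auto)
    then show ?thesis by simp
  qed
  have y_pos: "0 < y t" if t: "t0 \<le> t" for t
  proof (rule ccontr)
    assume "\<not> 0 < y t"
    define \<tau> where "\<tau> = t + 1"
    define \<eta> where "\<eta> = - y \<tau>"
    have \<eta>: "0 < \<eta>" using y_decr[of t \<tau>] t \<open>\<not> 0 < y t\<close> by (simp add: \<eta>_def \<tau>_def)
    have tau: "t0 < \<tau>" using t by (simp add: \<tau>_def)
    \<comment> \<open>After \<tau> the derivative of w is at least B \<eta>, so w would have reached 0 by this time.\<close>
    define s where "s = \<tau> - w \<tau> / (B * \<eta>)"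
    have s: "\<tau> < s" using w_neg[OF tau] B \<eta> by (simp add: s_def divide_neg_pos)
    have "w \<tau> - B * \<eta> * \<tau> \<le> w s - B * \<eta> * s"
    proof (rule half_line_derivative_nondecreasing[where f = "\<lambda>t. w t - B * \<eta> * t"])
      show "((\<lambda>t. w t - B * \<eta> * t) has_real_derivative - B * y r - B * \<eta>) (at r within {t0..})"
        if "t0 \<le> r" for r
        by (auto intro!: derivative_eq_intros Dw that)
      show "0 \<le> - B * y r - B * \<eta>" if "\<tau> < r" "r < s" for r
      proof -
        have "0 \<le> B * (- y r - \<eta>)"
          using y_decr[of \<tau> r] tau B that by (simp add: \<eta>_def)
        then show ?thesis by (simp add: algebra_simps)
      qed
    qed (use tau s in auto)
    also have "w s - B * \<eta> * s = w s - B * \<eta> * \<tau> + w \<tau>"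
      using B \<eta> by (simp add: s_def algebra_simps)
    finally show False using w_neg[of s] s tau by simp
  qed
  show thesis by (rule that[OF yw y0 w0 y_pos w_neg])
qed

text \<open>
The integral of g over {t0..T} is at least (H T - H t0) / K, which exceeds every bound as T grows.
\<close>

lemma nn_integral_infinite_if_unbounded_primitive:
  fixes H H' g :: "real \<Rightarrow> real"
  assumes D: "\<And>t. t0 \<le> t \<Longrightarrow> (H has_real_derivative H' t) (at t within {t0..})"
    and H': "\<And>t. t0 \<le> t \<Longrightarrow> 0 \<le> H' t \<and> H' t \<le> K * g t" and K: "0 < K"
    and unbounded: "\<And>M. \<exists>t\<ge>t0. M < H t"
  shows "(\<integral>\<^sup>+t\<in>{t0..}. ennreal (g t) \<partial>lborel) = \<infinity>"
proof (rule ccontr)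
  assume "(\<integral>\<^sup>+t\<in>{t0..}. ennreal (g t) \<partial>lborel) \<noteq> \<infinity>"
  then obtain r where r: "0 \<le> r" "(\<integral>\<^sup>+t\<in>{t0..}. ennreal (g t) \<partial>lborel) = ennreal r"
    by (metis ennreal_cases infinity_ennreal_def)
  obtain T where T: "t0 \<le> T" "H t0 + K * (r + 1) < H T" using unbounded by blast
  have "((\<lambda>t. H' t / K) has_integral (H T / K - H t0 / K)) {t0..T}"
  proof (rule fundamental_theorem_of_calculus[OF T(1)])
    fix t assume "t \<in> {t0..T}"
    then show "((\<lambda>t. H t / K) has_vector_derivative H' t / K) (at t within {t0..T})"
      unfolding has_real_derivative_iff_has_vector_derivative[symmetric]
      by (intro DERIV_cdivide DERIV_subset[OF D]) auto
  qed
  then have "ennreal (H T / K - H t0 / K) = (\<integral>\<^sup>+t\<in>{t0..T}. ennreal (H' t / K) \<partial>lborel)"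
    by (intro nn_integral_has_integral_lebesgue'[symmetric]) (use H' K in auto)
  also have "\<dots> \<le> (\<integral>\<^sup>+t\<in>{t0..}. ennreal (g t) \<partial>lborel)"
  proof (rule nn_integral_mono)
    fix t
    show "ennreal (H' t / K) * indicator {t0..T} t \<le> ennreal (g t) * indicator {t0..} t"
      using H'[of t] K by (auto simp: indicator_def field_simps intro!: ennreal_leI)
  qed
  finally have "H T / K - H t0 / K \<le> r" using r by (simp add: ennreal_le_iff)
  then have "H T \<le> H t0 + K * r" using K by (simp add: field_simps)
  then show False using T(2) K by (simp add: algebra_simps)
qed

lemma quotient_bound_if_wronskian_nonpos:
  assumes x: "sl_system a b G t0 x z" and p: "sl_system a c H t0 p q"
    and a: "\<And>t. t0 \<le> t \<Longrightarrow> 0 < a t" and p_pos: "\<And>t. t0 \<le> t \<Longrightarrow> 0 < p t"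
    and W: "\<And>t. t0 \<le> t \<Longrightarrow> z t * p t - x t * q t \<le> 0" and t: "t0 \<le> t"
  shows "x t \<le> x t0 / p t0 * p t"
proof -
  have "- (x t0 / p t0) \<le> - (x t / p t)"
  proof (rule half_line_derivative_nondecreasing[where f = "\<lambda>t. - (x t / p t)"])
    fix s assume s: "t0 \<le> s"
    show "((\<lambda>t. - (x t / p t)) has_real_derivative - (z s * p s - x s * q s) / (a s * (p s)\<^sup>2))
        (at s within {t0..})"
      using a[OF s] p_pos[OF s]
      by (auto intro!: derivative_eq_intros sl_systemD[OF x s] sl_systemD[OF p s]
          simp: field_simps power2_eq_square)
  next
    fix s assume "t0 < s"
    then show "0 \<le> - (z s * p s - x s * q s) / (a s * (p s)\<^sup>2)"
      using a[of s] p_pos[of s] W[of s] by (intro divide_nonneg_pos) auto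
  qed (use t in auto)
  then show ?thesis using p_pos[OF t] by (simp add: field_simps)
qed

text \<open>
The equation (a p')' + B p = 0 has a principal solution p, one for which the integral of 1 / (a p^2)
diverges: either y itself or, if h = \<integral>1 / (a y^2) stays bounded, the solution p = y R, where R is the tail
of that integral, obtained by reduction of order. Then 1 / (a p^2) has the primitive 1 / R, which is unbounded as
R tends to 0. The Wronskian inequality makes x / p nonincreasing, so x is bounded by a multiple of p and
inherits the divergence.
\<close>

lemma principal_if_wronskians_nonpos:
  assumes x: "sl_system a b G t0 x z" and y: "sl_system a (\<lambda>_. B) (\<lambda>u. u) t0 y w"
    and a: "continuous_on {t0..} a" "\<And>t. t0 \<le> t \<Longrightarrow> 0 < a t"
    and y_pos: "\<And>t. t0 \<le> t \<Longrightarrow> 0 < y t" and x_pos: "\<And>t. t0 \<le> t \<Longrightarrow> 0 < x t"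
    and W: "\<And>p q t. sl_system a (\<lambda>_. B) (\<lambda>u. u) t0 p q \<Longrightarrow> \<forall>t\<ge>t0. 0 < p t \<Longrightarrow> t0 \<le> t \<Longrightarrow>
      z t * p t - x t * q t \<le> 0"
  shows "(\<integral>\<^sup>+t\<in>{t0..}. ennreal (1 / (a t * (x t)\<^sup>2)) \<partial>lborel) = \<infinity>"
proof -
  define h where "h = (\<lambda>t. integral {t0..t} (\<lambda>s. 1 / (a s * (y s)\<^sup>2)))"
  have h_cont: "continuous_on {t0..} (\<lambda>s. 1 / (a s * (y s)\<^sup>2))"
    by (intro continuous_intros a sl_system_continuous[OF y]) (auto dest: a(2) y_pos)
  have Dh: "(h has_real_derivative 1 / (a t * (y t)\<^sup>2)) (at t within {t0..})" if "t0 \<le> t" for t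
    unfolding h_def has_real_derivative_iff_has_vector_derivative
    by (rule integral_has_vector_derivative_atLeast[OF h_cont that])
  have compare: "1 / (a t * (p t)\<^sup>2) \<le> (x t0 / p t0)\<^sup>2 * (1 / (a t * (x t)\<^sup>2))"
    if p: "sl_system a (\<lambda>_. B) (\<lambda>u. u) t0 p q" "\<And>t. t0 \<le> t \<Longrightarrow> 0 < p t" and t: "t0 \<le> t" for p q t
  proof -
    have "x t \<le> x t0 / p t0 * p t"
      by (rule quotient_bound_if_wronskian_nonpos[OF x p(1) a(2) p(2) W[OF p(1)] t]) (use p(2) in auto)
    then have "(x t)\<^sup>2 \<le> (x t0 / p t0 * p t)\<^sup>2"
      using x_pos[OF t] by (intro power_mono) auto
    then show ?thesis
      using x_pos[OF t] p(2)[OF t] p(2)[of t0] a(2)[OF t] by (simp add: field_simps power_mult_distrib)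
  qed
  show ?thesis
  proof (cases "\<forall>M. \<exists>t\<ge>t0. M < h t")
    case True
    show ?thesis
    proof (rule nn_integral_infinite_if_unbounded_primitive[OF Dh])
      show "0 \<le> 1 / (a t * (y t)\<^sup>2) \<and> 1 / (a t * (y t)\<^sup>2) \<le> (x t0 / y t0)\<^sup>2 * (1 / (a t * (x t)\<^sup>2))"
        if "t0 \<le> t" for t
        using compare[OF y y_pos that] a(2)[OF that] by auto
      show "0 < (x t0 / y t0)\<^sup>2" using x_pos[of t0] y_pos[of t0] by simp
    qed (use True in auto)
  next
    case False
    then obtain M where M: "\<And>t. t0 \<le> t \<Longrightarrow> h t \<le> M" by (meson not_less)
    have bdd: "bdd_above (h ` {t0..})" using M by (auto intro!: bdd_aboveI2)
    define R where "R = (\<lambda>t. (SUP s\<in>{t0..}. h s) - h t)"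
    have R_pos: "0 < R t" if t: "t0 \<le> t" for t
    proof -
      have "h t < h (t + 1)"
      proof (rule half_line_derivative_increasing[OF Dh])
        show "0 < 1 / (a r * (y r)\<^sup>2)" if "t < r" for r
          using t that a(2)[of r] y_pos[of r] by simp
      qed (use t in auto)
      also have "\<dots> \<le> (SUP s\<in>{t0..}. h s)" by (rule cSUP_upper[OF _ bdd]) (use t in auto)
      finally show ?thesis by (simp add: R_def)
    qed
    have DR: "(R has_real_derivative - (1 / (a t * (y t)\<^sup>2))) (at t within {t0..})" if "t0 \<le> t" for t
      unfolding R_def by (auto intro!: derivative_eq_intros Dh that)
    define p where "p = (\<lambda>t. y t * R t)"
    define q where "q = (\<lambda>t. w t * R t - 1 / y t)"
    have p_pos: "0 < p t" if "t0 \<le> t" for t using y_pos[OF that] R_pos[OF that] by (simp add: p_def)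
    have p: "sl_system a (\<lambda>_. B) (\<lambda>u. u) t0 p q"
      unfolding sl_system_def
    proof (intro allI impI conjI)
      fix t assume t: "t0 \<le> t"
      show "(p has_real_derivative q t / a t) (at t within {t0..})"
        unfolding p_def q_def using a(2)[OF t] y_pos[OF t]
        by (auto intro!: derivative_eq_intros sl_systemD[OF y t] DR[OF t]
            simp: field_simps power2_eq_square)
      show "(q has_real_derivative - B * p t) (at t within {t0..})"
        unfolding p_def q_def using a(2)[OF t] y_pos[OF t]
        by (auto intro!: derivative_eq_intros sl_systemD[OF y t] DR[OF t]
            simp: field_simps power2_eq_square)
    qed
    show ?thesis
    proof (rule nn_integral_infinite_if_unbounded_primitive)
      fix t assume t: "t0 \<le> t"
      show "((\<lambda>t. 1 / R t) has_real_derivative 1 / (a t * (p t)\<^sup>2)) (at t within {t0..})"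
        unfolding p_def using a(2)[OF t] y_pos[OF t] R_pos[OF t]
        by (auto intro!: derivative_eq_intros DR[OF t] simp: field_simps power2_eq_square)
      show "0 \<le> 1 / (a t * (p t)\<^sup>2) \<and> 1 / (a t * (p t)\<^sup>2) \<le> (x t0 / p t0)\<^sup>2 * (1 / (a t * (x t)\<^sup>2))"
        using compare[OF p p_pos t] a(2)[OF t] by auto
    next
      show "0 < (x t0 / p t0)\<^sup>2" using x_pos[of t0] p_pos[of t0] by simp
      fix N :: real
      define e where "e = 1 / (\<bar>N\<bar> + 1)"
      have "(SUP s\<in>{t0..}. h s) - e < (SUP s\<in>{t0..}. h s)" by (simp add: e_def)
      then obtain t where t: "t0 \<le> t" "(SUP s\<in>{t0..}. h s) - e < h t"
        using less_cSUP_iff[OF _ bdd] by auto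
      have "R t < e" using t by (simp add: R_def)
      then have "1 / e < 1 / R t" using R_pos[OF t(1)] by (simp add: frac_less2)
      moreover have "N < 1 / e" by (simp add: e_def)
      ultimately show "\<exists>t\<ge>t0. N < 1 / R t" using t(1) by (intro exI[of _ t]) auto
    qed
  qed
qed

text \<open>
If x stayed above a positive constant, 1 / (a x^2) would be dominated by a multiple of the integrable
function 1 / a.
\<close>

lemma decreasing_principal_tendsto_0:
  fixes a x :: "real \<Rightarrow> real"
  assumes a: "\<And>t. t0 \<le> t \<Longrightarrow> 0 < a t" and a_int: "(\<lambda>t. 1 / a t) integrable_on {t0..}"
    and x_pos: "\<And>t. t0 \<le> t \<Longrightarrow> 0 < x t" and decr: "\<And>s t. t0 \<le> s \<Longrightarrow> s < t \<Longrightarrow> x t < x s"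
    and inf: "(\<integral>\<^sup>+t\<in>{t0..}. ennreal (1 / (a t * (x t)\<^sup>2)) \<partial>lborel) = \<infinity>"
  shows "(x \<longlongrightarrow> 0) at_top"
proof (rule tendstoI)
  fix e :: real assume e: "0 < e"
  have "\<exists>s\<ge>t0. x s < e"
  proof (rule ccontr)
    assume "\<not> ?thesis"
    then have ge: "e \<le> x t" if "t0 \<le> t" for t using that by force
    obtain I where "((\<lambda>t. 1 / a t) has_integral I) {t0..}" using a_int by blast
    from has_integral_mult_right[OF this, of "1 / e\<^sup>2"]
    have "(\<integral>\<^sup>+t\<in>{t0..}. ennreal (1 / e\<^sup>2 * (1 / a t)) \<partial>lborel) = ennreal (1 / e\<^sup>2 * I)"
      by (intro nn_integral_has_integral_lebesgue') (use a in \<open>auto simp: less_imp_le\<close>)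
    moreover have "(\<integral>\<^sup>+t\<in>{t0..}. ennreal (1 / (a t * (x t)\<^sup>2)) \<partial>lborel)
        \<le> (\<integral>\<^sup>+t\<in>{t0..}. ennreal (1 / e\<^sup>2 * (1 / a t)) \<partial>lborel)"
    proof (rule nn_integral_mono)
      fix t
      have "1 / (a t * (x t)\<^sup>2) \<le> 1 / e\<^sup>2 * (1 / a t)" if t: "t0 \<le> t"
      proof -
        have "e\<^sup>2 \<le> (x t)\<^sup>2" using ge[OF t] e by (intro power_mono) auto
        then show ?thesis using a[OF t] e x_pos[OF t] by (simp add: field_simps)
      qed
      then show "ennreal (1 / (a t * (x t)\<^sup>2)) * indicator {t0..} t
          \<le> ennreal (1 / e\<^sup>2 * (1 / a t)) * indicator {t0..} t"
        by (auto simp: indicator_def intro!: ennreal_leI)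
    qed
    ultimately show False using inf by (simp add: top_unique)
  qed
  then obtain s where s: "t0 \<le> s" "x s < e" by blast
  show "\<forall>\<^sub>F t in at_top. dist (x t) 0 < e"
    using eventually_gt_at_top[of s]
  proof eventually_elim
    case (elim t)
    then show ?case using decr[of s t] x_pos[of t] s by (simp add: dist_real_def)
  qed
qed

section \<open>Concavity on the unit interval\<close>

text \<open>
The data after F has been replaced by G(u) = F(max u 0). Throughout, z(0) is the shooting parameter.
\<close>

locale shooting =
  fixes a b G A :: "real \<Rightarrow> real" and B :: real
  assumes a_cont: "continuous_on {0..} a" and a_pos: "\<And>t. 0 \<le> t \<Longrightarrow> 0 < a t"
    and b_cont: "continuous_on {0..} b" and b_nonneg: "\<And>t. 0 \<le> t \<Longrightarrow> t \<le> 1 \<Longrightarrow> 0 \<le> b t"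
    and b_le: "\<And>t. 1 \<le> t \<Longrightarrow> b t \<le> B" and B_nonneg: "0 \<le> B"
    and A_deriv: "\<And>t. 0 \<le> t \<Longrightarrow> (A has_real_derivative 1 / a t) (at t within {0..})" and A_0: "A 0 = 0"
    and G_lip: "\<And>u v. \<bar>G u - G v\<bar> \<le> \<bar>u - v\<bar>" and G_mono: "\<And>u v. u \<le> v \<Longrightarrow> G u \<le> G v"
    and G_0: "G 0 = 0" and G_nonneg: "\<And>u. 0 \<le> G u"
begin

lemma A_increasing: "A s < A t" if "0 \<le> s" "s < t"
  by (rule half_line_derivative_increasing[OF A_deriv]) (use that a_pos in auto)

lemma A_mono: "A s \<le> A t" if "0 \<le> s" "s \<le> t"
  using A_increasing[of s t] that by (cases "s = t") auto

lemma A_pos: "0 < A t" if "0 < t"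
  using A_increasing[of 0 t] that A_0 by simp

lemma G_le: "G u \<le> u" if "0 \<le> u"
  using G_lip[of u 0] G_0 that by simp

lemma G_cont: "continuous_on S G"
  by (rule lipschitz_on_continuous_on[of 1]) (auto simp: lipschitz_on_def dist_real_def G_lip)

context
  fixes x z
  assumes sys: "sl_system a b G 0 x z" and x_0: "x 0 = 0"
begin

lemma flux_drop: "((\<lambda>r. b r * G (x r)) has_integral (z s - z t)) {s..t}" if "0 \<le> s" "s \<le> t"
proof -
  have "((\<lambda>r. - b r * G (x r)) has_integral (z t - z s)) {s..t}"
    by (rule fundamental_theorem_of_calculus[OF \<open>s \<le> t\<close>],
        unfold has_real_derivative_iff_has_vector_derivative[symmetric],
        rule DERIV_subset[OF sl_systemD(2)[OF sys]])
      (use that in auto)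
  from has_integral_neg[OF this] show ?thesis by simp
qed

lemma flux_decreasing: "z t \<le> z s" if "0 \<le> s" "s \<le> t" "t \<le> 1"
  using has_integral_nonneg[OF flux_drop[of s t]] that b_nonneg G_nonneg by auto

text \<open>
On [0, 1] the flux is nonincreasing, so x is a concave function of A with slope z; these are the tangent
line inequalities in the variable A.
\<close>

lemma concave_tangents:
  assumes "0 \<le> r" "r \<le> t" "t \<le> 1"
  shows "z t * (A t - A r) \<le> x t - x r" and "x t - x r \<le> z r * (A t - A r)"
proof -
  \<comment> \<open>One formula for both inequalities: c = 1 with k = z t, and c = - 1 with k = z r.\<close>
  have D: "((\<lambda>s. c * (x s - k * A s)) has_real_derivative c * ((z s - k) / a s)) (at s within {0..})"
    if "0 \<le> s" for c k s
    by (auto intro!: derivative_eq_intros sl_systemD[OF sys that] A_deriv[OF that] simp: diff_divide_distrib)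
  have "1 * (x r - z t * A r) \<le> 1 * (x t - z t * A t)"
    by (rule half_line_derivative_nondecreasing[where f = "\<lambda>s. 1 * (x s - z t * A s)", OF D])
      (use assms flux_decreasing[of _ t] a_pos in \<open>auto intro!: divide_nonneg_pos\<close>)
  then show "z t * (A t - A r) \<le> x t - x r" by (simp add: algebra_simps)
  have "- 1 * (x r - z r * A r) \<le> - 1 * (x t - z r * A t)"
    by (rule half_line_derivative_nondecreasing[where f = "\<lambda>s. - 1 * (x s - z r * A s)", OF D])
      (use assms flux_decreasing[of r] a_pos in \<open>auto intro!: divide_nonneg_pos\<close>)
  then show "x t - x r \<le> z r * (A t - A r)" by (simp add: algebra_simps)
qed

lemma above_flux_ray: "z t * A t \<le> x t" if "0 \<le> t" "t \<le> 1"
  using concave_tangents(1)[of 0 t] that x_0 A_0 by simp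

lemma below_initial_ray: "x t \<le> z 0 * A t" if "0 \<le> t" "t \<le> 1"
  using concave_tangents(2)[of 0 t] that x_0 A_0 by simp

lemma positive_if_positive_at_1: "0 < x t" if "0 < x 1" "0 < t" "t \<le> 1"
proof (cases "0 < z t")
  case True
  then have "0 < z t * A t" using A_pos that by simp
  then show ?thesis using above_flux_ray[of t] that by simp
next
  case False
  then have "z t * (A 1 - A t) \<le> 0" using A_mono[of t 1] that by (simp add: mult_nonpos_nonneg)
  then show ?thesis using concave_tangents(2)[of t 1] that by simp
qed

lemma above_chord_to_1: "x s * (A 1 - A t) \<le> x t * (A 1 - A s)"
  if "0 \<le> x 1" "0 \<le> s" "s \<le> t" "t \<le> 1"
proof -
  have "- x t * (A t - A s) \<le> (x 1 - x t) * (A t - A s)"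
    using that A_mono[of s t] by (intro mult_right_mono) auto
  also have "\<dots> \<le> z t * (A 1 - A t) * (A t - A s)"
    using that A_mono[of s t] concave_tangents(2)[of t 1] by (intro mult_right_mono) auto
  also have "\<dots> = z t * (A t - A s) * (A 1 - A t)" by simp
  also have "\<dots> \<le> (x t - x s) * (A 1 - A t)"
    using that A_mono[of t 1] concave_tangents(1)[of s t] by (intro mult_right_mono) auto
  finally show ?thesis by (simp add: algebra_simps)
qed

text \<open>
Below its initial tangent the solution never exceeds z(0) A(1), which bounds the total loss of flux on
[0, 1].
\<close>

lemma increasing_phase:
  assumes "G (z 0 * A 1) * integral {0..1} b < z 0"
  shows "0 < z 1" and "\<And>t. 0 < t \<Longrightarrow> t \<le> 1 \<Longrightarrow> 0 < x t"
proof -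
  have b_int: "b integrable_on {0..1}"
    by (intro integrable_continuous_real continuous_on_subset[OF b_cont]) auto
  have "0 \<le> integral {0..1} b" by (rule integral_nonneg[OF b_int]) (use b_nonneg in auto)
  then have z0: "0 < z 0"
    using assms G_nonneg[of "z 0 * A 1"] by (smt (verit) mult_nonneg_nonneg)
  have "z 0 - z 1 \<le> integral {0..1} (\<lambda>t. G (z 0 * A 1) * b t)"
  proof (rule has_integral_le[OF flux_drop integrable_integral])
    show "(\<lambda>t. G (z 0 * A 1) * b t) integrable_on {0..1}" using b_int by (intro integrable_on_mult_right) auto
    fix t :: real assume t: "t \<in> {0..1}"
    have "x t \<le> z 0 * A 1"
      using below_initial_ray[of t] t z0 A_mono[of t 1] by (smt (verit) atLeastAtMost_iff mult_left_mono)
    then show "b t * G (x t) \<le> G (z 0 * A 1) * b t"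
      using b_nonneg[of t] t by (subst mult.commute) (auto intro!: mult_right_mono G_mono)
  qed auto
  then show z1: "0 < z 1" using assms by simp
  show "0 < x t" if t: "0 < t" "t \<le> 1" for t
  proof -
    have "0 < z t" using z1 flux_decreasing[of t 1] t by simp
    then show ?thesis using above_flux_ray[of t] A_pos[of t] t by (smt (verit) mult_pos_pos)
  qed
qed

text \<open>
By concavity x is at least m = min (x t1) (x t2) on [t1, t2], so the flux drops there by at least
G(m) \<integral>b. On the other hand a drop J leaves room for x(0) = 0 and x(1) > 0 only if
J A(t1) (A(1) - A(t2)) < x(ti) A(1) for i = 1, 2. These are the estimates of the Green function of the
Dirichlet problem on [0, 1] at its corners, derived from tangents.
\<close>

lemma green_bound:
  assumes t12: "0 < t1" "t1 < t2" "t2 < 1" and x1: "0 < x 1"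
  shows "G (min (x t1) (x t2)) * integral {t1..t2} b * (A t1 * (A 1 - A t2)) < min (x t1) (x t2) * A 1"
proof -
  define \<mu> where "\<mu> = min (x t1) (x t2)"
  define J where "J = z t1 - z t2"
  have mu: "\<mu> \<le> x t" if t: "t1 \<le> t" "t \<le> t2" for t
  proof (cases "0 \<le> z t")
    case True
    then have "0 \<le> z t * (A t - A t1)" using A_mono[of t1 t] t t12 by simp
    then show ?thesis using concave_tangents(1)[of t1 t] t t12 by (simp add: \<mu>_def)
  next
    case False
    then have "z t * (A t2 - A t) \<le> 0" using A_mono[of t t2] t t12 by (simp add: mult_nonpos_nonneg)
    then show ?thesis using concave_tangents(2)[of t t2] t t12 by (simp add: \<mu>_def)
  qed
  have b_int: "b integrable_on {t1..t2}"
    by (intro integrable_continuous_real continuous_on_subset[OF b_cont]) (use t12 in auto)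
  have "integral {t1..t2} (\<lambda>t. G \<mu> * b t) \<le> J"
    unfolding J_def
  proof (rule has_integral_le[OF integrable_integral flux_drop])
    show "(\<lambda>t. G \<mu> * b t) integrable_on {t1..t2}" using b_int by (intro integrable_on_mult_right) auto
    fix t assume t: "t \<in> {t1..t2}"
    then show "G \<mu> * b t \<le> b t * G (x t)"
      using b_nonneg[of t] t12 mu[of t] by (subst mult.commute) (auto intro!: mult_left_mono G_mono)
  qed (use t12 in auto)
  then have J: "G \<mu> * integral {t1..t2} b \<le> J" by simp
  have A1: "0 < A t1" and A2: "A t2 < A 1" and A12: "A t1 < A t2"
    using t12 A_pos[of t1] A_increasing[of t2 1] A_increasing[of t1 t2] by auto
  have first: "z t1 * A t1 \<le> x t1" by (rule above_flux_ray) (use t12 in auto)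
  have last: "x 1 - x t2 \<le> z t2 * (A 1 - A t2)" by (rule concave_tangents(2)) (use t12 in auto)
  have mid1: "x t2 - x t1 \<le> z t1 * (A t2 - A t1)" by (rule concave_tangents(2)) (use t12 in auto)
  have mid2: "z t2 * (A t2 - A t1) \<le> x t2 - x t1" by (rule concave_tangents(1)) (use t12 in auto)
  have at1: "J * (A t1 * (A 1 - A t2)) < x t1 * A 1"
  proof -
    have "J * (A 1 - A t2) < x t1 + z t1 * (A 1 - A t1)"
      using mid1 last x1 by (simp add: J_def algebra_simps)
    then have "J * (A 1 - A t2) * A t1 < (x t1 + z t1 * (A 1 - A t1)) * A t1"
      using A1 by (rule mult_strict_right_mono)
    also have "\<dots> = x t1 * A t1 + z t1 * A t1 * (A 1 - A t1)" by (simp add: algebra_simps)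
    also have "\<dots> \<le> x t1 * A t1 + x t1 * (A 1 - A t1)"
      using first A2 A12 by (intro add_left_mono mult_right_mono) auto
    finally show ?thesis by (simp add: algebra_simps)
  qed
  have at2: "J * (A t1 * (A 1 - A t2)) < x t2 * A 1"
  proof -
    have "J * A t1 + z t2 * A t2 \<le> x t2"
      using mid2 first by (simp add: J_def algebra_simps)
    then have "(J * A t1 + z t2 * A t2) * (A 1 - A t2) \<le> x t2 * (A 1 - A t2)"
      using A2 by (intro mult_right_mono) auto
    moreover have "- x t2 * A t2 < z t2 * (A 1 - A t2) * A t2"
      using last x1 A1 A12 by (intro mult_strict_right_mono) auto
    ultimately show ?thesis by (simp add: algebra_simps)
  qed
  have "G \<mu> * integral {t1..t2} b * (A t1 * (A 1 - A t2)) \<le> J * (A t1 * (A 1 - A t2))"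
    using J A1 A2 by (intro mult_right_mono) auto
  also have "\<dots> < \<mu> * A 1" using at1 at2 by (auto simp: \<mu>_def min_def)
  finally show ?thesis by (simp add: \<mu>_def)
qed

text \<open>
If x(t1) is small compared with z(0), the chord from t1 to 1 makes x small on [0, t1], so only little flux is
lost there, and x(t1) \<ge> z(t1) A(t1) cannot be small. The chord inequality then passes from t1 to t2.
\<close>

lemma values_comparable_to_slope:
  assumes t12: "0 < t1" "t1 < t2" "t2 < 1" and x1: "0 < x 1"
  shows "z 0 * (A t1 * (A 1 - A t2))
      \<le> min (x t1) (x t2) * (A 1 - A t1 + A 1 * A t1 * integral {0..1} b)"
proof -
  let ?\<beta> = "integral {0..1} b"
  have A1: "0 < A t1" and A2: "A t2 < A 1" and A12: "A t1 < A t2"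
    using t12 A_pos[of t1] A_increasing[of t2 1] A_increasing[of t1 t2] by auto
  have b_int: "b integrable_on S" if "S = {0..t1} \<or> S = {0..1}" for S
    using that by (auto intro!: integrable_continuous_real continuous_on_subset[OF b_cont])
  have xt1: "0 < x t1" by (rule positive_if_positive_at_1) (use t12 x1 in auto)
  \<comment> \<open>The value at 0 of the line, in the variable A, through the point at t1 and a zero at 1.\<close>
  define \<kappa> where "\<kappa> = x t1 * A 1 / (A 1 - A t1)"
  have \<kappa>: "0 \<le> \<kappa>" using xt1 A1 A2 A12 by (simp add: \<kappa>_def)
  have "z 0 - z t1 \<le> integral {0..t1} (\<lambda>t. \<kappa> * b t)"
  proof (rule has_integral_le[OF flux_drop integrable_integral])
    show "(\<lambda>t. \<kappa> * b t) integrable_on {0..t1}" using b_int by (intro integrable_on_mult_right) auto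
    fix t assume t: "t \<in> {0..t1}"
    have xt: "0 \<le> x t"
      using positive_if_positive_at_1[of t] x1 t t12 x_0 by (cases "t = 0") auto
    have "x t * (A 1 - A t1) \<le> x t1 * (A 1 - A t)" by (rule above_chord_to_1) (use t t12 x1 in auto)
    also have "\<dots> \<le> x t1 * A 1" using xt1 A_mono[of 0 t] A_0 t by (intro mult_left_mono) auto
    finally have "x t \<le> \<kappa>" using A2 A12 by (simp add: \<kappa>_def field_simps)
    then have "G (x t) \<le> \<kappa>" using G_le[OF xt] by simp
    then show "b t * G (x t) \<le> \<kappa> * b t"
      using b_nonneg[of t] t t12 by (subst mult.commute) (auto intro!: mult_right_mono)
  qed (use t12 in auto)
  also have "\<dots> = \<kappa> * integral {0..t1} b" by simp
  also have "\<dots> \<le> \<kappa> * ?\<beta>"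
    by (intro mult_left_mono \<kappa> integral_subset_le b_int) (use t12 b_nonneg in auto)
  finally have "(z 0 - z t1) * A t1 \<le> \<kappa> * ?\<beta> * A t1" using A1 by (intro mult_right_mono) auto
  moreover have "z t1 * A t1 \<le> x t1" by (rule above_flux_ray) (use t12 in auto)
  ultimately have "z 0 * A t1 \<le> x t1 + \<kappa> * ?\<beta> * A t1" by (simp add: algebra_simps)
  also have "\<dots> = x t1 * (A 1 - A t1 + A 1 * A t1 * ?\<beta>) / (A 1 - A t1)"
    using A2 A12 by (simp add: \<kappa>_def field_simps)
  finally have main: "z 0 * A t1 * (A 1 - A t1) \<le> x t1 * (A 1 - A t1 + A 1 * A t1 * ?\<beta>)"
    using A2 A12 by (simp add: field_simps)
  have \<beta>: "0 \<le> ?\<beta>" by (rule integral_nonneg[OF b_int]) (use b_nonneg in auto)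
  have E: "0 < A 1 - A t1 + A 1 * A t1 * ?\<beta>"
    using A1 A2 A12 \<beta> by (intro add_pos_nonneg mult_nonneg_nonneg) auto
  have z0: "0 < z 0"
    using below_initial_ray[of 1] x1 A_pos[of 1] by (simp add: zero_less_mult_iff) (smt (verit) mult_nonneg_nonneg mult_nonpos_nonneg)
  have t1: "z 0 * (A t1 * (A 1 - A t2)) \<le> x t1 * (A 1 - A t1 + A 1 * A t1 * ?\<beta>)"
  proof -
    have "z 0 * A t1 * (A 1 - A t2) \<le> z 0 * A t1 * (A 1 - A t1)"
      using z0 A1 A12 by (intro mult_left_mono) auto
    then show ?thesis using main by (simp add: mult.assoc)
  qed
  have t2: "z 0 * (A t1 * (A 1 - A t2)) \<le> x t2 * (A 1 - A t1 + A 1 * A t1 * ?\<beta>)"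
  proof -
    have "z 0 * (A t1 * (A 1 - A t2)) * (A 1 - A t1) = z 0 * A t1 * (A 1 - A t1) * (A 1 - A t2)"
      by simp
    also have "\<dots> \<le> x t1 * (A 1 - A t1 + A 1 * A t1 * ?\<beta>) * (A 1 - A t2)"
      using main A2 by (intro mult_right_mono) auto
    also have "\<dots> = x t1 * (A 1 - A t2) * (A 1 - A t1 + A 1 * A t1 * ?\<beta>)" by simp
    also have "\<dots> \<le> x t2 * (A 1 - A t1) * (A 1 - A t1 + A 1 * A t1 * ?\<beta>)"
      using above_chord_to_1[of t1 t2] E t12 x1 by (intro mult_right_mono) auto
    finally show ?thesis using A2 A12 by (simp add: mult.assoc mult.commute[of "A 1 - A t1"] mult_le_cancel_right)
  qed
  show ?thesis using t1 t2 by (simp add: min_def)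
qed

text \<open>
A first zero without a change of sign would be a double zero, and backward uniqueness would make
the solution vanish identically.
\<close>

lemma negative_if_hits_zero:
  assumes z_0: "z 0 \<noteq> 0" and t: "0 < t" "x t \<le> 0"
  obtains s where "0 < s" "x s < 0"
proof -
  have "\<exists>s>0. x s < 0"
  proof (rule ccontr)
    assume "\<not> ?thesis"
    then have nonneg: "0 \<le> x s" if "0 < s" for s using that by force
    have xt: "x t = 0" using nonneg[OF t(1)] t by simp
    have "z t / a t = 0"
    proof (rule DERIV_local_min)
      show "DERIV x t :> z t / a t"
        by (rule half_line_derivative_at[OF sl_systemD(1)[OF sys]]) (use t in auto)
      show "\<forall>s. \<bar>t - s\<bar> < t \<longrightarrow> x t \<le> x s" using nonneg xt by auto
    qed (rule t)
    then have zt: "z t = 0" using a_pos[of t] t by simp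
    obtain K where K: "\<And>s. s \<in> {0..t} \<Longrightarrow> 1 / a s + \<bar>b s\<bar> \<le> K"
      using sl_system_coefficient_bound[OF a_cont a_pos b_cont] by blast
    have "sl_system a b G 0 (\<lambda>_. 0) (\<lambda>_. 0)" by (simp add: sl_system_def G_0)
    then have "(x 0 - 0)\<^sup>2 + (z 0 - 0)\<^sup>2 \<le> ((x t - 0)\<^sup>2 + (z t - 0)\<^sup>2) * exp (K * \<bar>0 - t\<bar>)"
      by (rule sl_system_dependence[OF sys _ a_pos G_lip K]) (use t in auto)
    then show False using x_0 z_0 xt zt by simp
  qed
  then show thesis using that by blast
qed

end

end

section \<open>The critical shooting parameter\<close>

context shooting
begin

lemma positive_after_increasing_phase:
  assumes sys: "sl_system a b G 0 x z" and x_0: "x 0 = 0"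
    and slope: "G (z 0 * A 1) * integral {0..1} b < z 0"
    and y: "sl_system a (\<lambda>_. B) (\<lambda>u. u) 1 y w" "y 1 = 1" "w 1 = 0" "\<And>t. 1 \<le> t \<Longrightarrow> 0 < y t"
    and t: "0 < t"
  shows "0 < x t"
proof (rule ccontr)
  assume neg: "\<not> 0 < x t"
  have z1: "0 < z 1" and pos: "\<And>t. 0 < t \<Longrightarrow> t \<le> 1 \<Longrightarrow> 0 < x t"
    using increasing_phase[OF sys x_0 slope] by auto
  have sys1: "sl_system a b G 1 x z" by (rule sl_system_later[OF sys]) simp
  have "1 \<le> t" using pos[of t] neg t by force
  then obtain T where T: "1 < T" "x T = 0" "\<And>s. 1 \<le> s \<Longrightarrow> s < T \<Longrightarrow> 0 < x s"
    using first_zero[OF sl_system_continuous(1)[OF sys1], of t] pos[of 1] neg by auto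
  have "z 1 * y 1 - x 1 * w 1 \<le> 0"
    by (rule wronskian_nonpos_before_zero[OF sys1 y(1) _ y(4) B_nonneg b_le _ T(1,2)])
      (use a_pos G_nonneg G_le T in \<open>auto intro: less_imp_le\<close>)
  then show False using z1 y by simp
qed

lemma shooting_continuous:
  assumes sys: "\<And>c. sl_system a b G 0 (X c) (Z c)" and X0: "\<And>c. X c 0 = 0" and Z0: "\<And>c. Z c 0 = c"
    and T: "0 \<le> T" and e: "0 < e"
  shows "\<exists>d>0. \<forall>c'. \<bar>c' - c\<bar> < d \<longrightarrow> (\<forall>t\<in>{0..T}. \<bar>X c' t - X c t\<bar> < e \<and> \<bar>Z c' t - Z c t\<bar> < e)"
proof -
  obtain K where K: "\<And>t. t \<in> {0..T} \<Longrightarrow> 1 / a t + \<bar>b t\<bar> \<le> K"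
    using sl_system_coefficient_bound[OF a_cont a_pos b_cont] by blast
  have "0 < 1 / a 0 + \<bar>b 0\<bar>" using a_pos[of 0] by (intro add_pos_nonneg) auto
  then have K0: "0 \<le> K" using K[of 0] T by simp
  define d where "d = e / exp (K * T)"
  have "0 < d" using e by (simp add: d_def)
  moreover have "\<bar>X c' t - X c t\<bar> < e \<and> \<bar>Z c' t - Z c t\<bar> < e"
    if close: "\<bar>c' - c\<bar> < d" and t: "t \<in> {0..T}" for c' t
  proof -
    define D where "D = (X c' t - X c t)\<^sup>2 + (Z c' t - Z c t)\<^sup>2"
    have "D \<le> ((X c' 0 - X c 0)\<^sup>2 + (Z c' 0 - Z c 0)\<^sup>2) * exp (K * \<bar>t - 0\<bar>)"
      unfolding D_def by (rule sl_system_dependence[OF sys sys a_pos G_lip K]) (use t in auto)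
    also have "\<dots> \<le> \<bar>c' - c\<bar>\<^sup>2 * exp (K * T)"
      using t K0 by (auto simp: X0 Z0 intro!: mult_left_mono)
    also have "\<dots> < d\<^sup>2 * exp (K * T)"
      using close by (intro mult_strict_right_mono power_strict_mono) auto
    also have "\<dots> \<le> d\<^sup>2 * (exp (K * T))\<^sup>2"
      using K0 T by (intro mult_left_mono) (auto simp: power2_eq_square)
    also have "\<dots> = e\<^sup>2" by (simp add: d_def power_divide)
    finally have "D < e\<^sup>2" .
    moreover have "(X c' t - X c t)\<^sup>2 \<le> D" "(Z c' t - Z c t)\<^sup>2 \<le> D" by (auto simp: D_def)
    ultimately have "\<bar>X c' t - X c t\<bar>\<^sup>2 < e\<^sup>2" "\<bar>Z c' t - Z c t\<bar>\<^sup>2 < e\<^sup>2" by auto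
    then show ?thesis using e by (meson less_imp_le power_less_imp_less_base)
  qed
  ultimately show ?thesis by blast
qed

text \<open>
The parameters whose solution has a positive zero form a relatively open set N, so by connectedness some c outside N is a
limit of points c' of N. Up to a given time t the solution for c is bounded away from zero on [1, t], hence the one for
nearby c' in N has its first zero only after t and has a nonpositive Wronskian at t. Letting c' tend to c gives
the claim.
\<close>

lemma critical_solution:
  assumes lo: "0 < \<alpha>" "\<And>x z t. sl_system a b G 0 x z \<Longrightarrow> x 0 = 0 \<Longrightarrow> z 0 = \<alpha> \<Longrightarrow> 0 < t \<Longrightarrow> 0 < x t"
    and hi: "0 < \<beta>" "\<And>x z. sl_system a b G 0 x z \<Longrightarrow> x 0 = 0 \<Longrightarrow> z 0 = \<beta> \<Longrightarrow> \<exists>t>0. x t \<le> 0"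
  obtains x z where "sl_system a b G 0 x z" "x 0 = 0" "\<And>t. 0 < t \<Longrightarrow> 0 < x t"
    and "\<And>p q t. sl_system a (\<lambda>_. B) (\<lambda>u. u) 1 p q \<Longrightarrow> \<forall>t\<ge>1. 0 < p t \<Longrightarrow> 1 \<le> t \<Longrightarrow>
      z t * p t - x t * q t \<le> 0"
proof -
  have "\<forall>c. \<exists>x z. sl_system a b G 0 x z \<and> x 0 = 0 \<and> z 0 = c"
    using sl_system_exists[OF a_cont a_pos b_cont G_lip] by metis
  then obtain X Z where sys: "\<And>c. sl_system a b G 0 (X c) (Z c)" and X0: "\<And>c. X c 0 = 0" and Z0: "\<And>c. Z c 0 = c"
    by metis
  define N where "N = {c. \<exists>t>0. X c t \<le> 0}"
  define I where "I = {min \<alpha> \<beta>..max \<alpha> \<beta>}"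
  have I_pos: "0 < c" if "c \<in> I" for c using that lo hi by (auto simp: I_def)
  have N_open: "\<exists>d>0. \<forall>c'. \<bar>c' - c\<bar> < d \<longrightarrow> c' \<in> N" if c: "c \<in> N" "c \<in> I" for c
  proof -
    obtain t where t: "0 < t" "X c t < 0"
      using c negative_if_hits_zero[OF sys X0, of c] Z0[of c] I_pos[of c] by (auto simp: N_def)
    obtain d where d: "0 < d" "\<And>c'. \<bar>c' - c\<bar> < d \<Longrightarrow> \<bar>X c' t - X c t\<bar> < - X c t"
      using shooting_continuous[OF sys X0 Z0, of t "- X c t" c] t by force
    have "c' \<in> N" if "\<bar>c' - c\<bar> < d" for c'
      using d(2)[OF that] t by (auto simp: N_def intro!: exI[of _ t])
    then show ?thesis using d(1) by blast
  qed
  have "\<exists>c\<in>I. c \<notin> N \<and> (\<forall>d>0. \<exists>c'\<in>N. \<bar>c' - c\<bar> < d)"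
  proof (rule ccontr)
    assume "\<not> ?thesis"
    then have compl: "\<exists>d>0. \<forall>c'. \<bar>c' - c\<bar> < d \<longrightarrow> c' \<notin> N" if "c \<in> I" "c \<notin> N" for c using that by blast
    have "openin (top_of_set I) (I \<inter> N)"
      unfolding openin_euclidean_subtopology_iff dist_real_def using N_open by blast
    moreover have "openin (top_of_set I) (I - N)"
      unfolding openin_euclidean_subtopology_iff dist_real_def using compl by blast
    moreover have "\<alpha> \<in> I - N" using lo(2)[OF sys X0 Z0] by (force simp: I_def N_def)
    moreover have "\<beta> \<in> I \<inter> N" using hi(2)[OF sys X0 Z0] by (auto simp: I_def N_def)
    ultimately have "\<not> connected I"
      unfolding connected_openin not_not
      by (intro exI[of _ "I \<inter> N"] exI[of _ "I - N"]) auto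
    then show False by (simp add: I_def)
  qed
  then obtain c where c: "c \<in> I" "c \<notin> N" and near: "\<And>d. 0 < d \<Longrightarrow> \<exists>c'\<in>N. \<bar>c' - c\<bar> < d" by blast
  have pos: "0 < X c t" if "0 < t" for t using c(2) that by (force simp: N_def)
  show thesis
  proof (rule that[OF sys X0 pos])
    fix p q t
    assume p: "sl_system a (\<lambda>_. B) (\<lambda>u. u) 1 p q" and "\<forall>t\<ge>1. 0 < p t" and t: "1 \<le> (t :: real)"
    then have p_pos: "0 < p t" if "1 \<le> t" for t using that by simp
    define W where "W = (\<lambda>c. Z c t * p t - X c t * q t)"
    have "W c \<le> 0"
    proof (rule ccontr)
      assume "\<not> W c \<le> 0"
      have "continuous_on {1..t} (X c)"
        by (rule continuous_on_subset[OF sl_system_continuous(1)[OF sys]]) auto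
      then obtain s where s: "s \<in> {1..t}" "\<And>r. r \<in> {1..t} \<Longrightarrow> X c s \<le> X c r"
        using continuous_attains_inf[of "{1..t}" "X c"] t by auto
      \<comment> \<open>This tolerance keeps the nearby solution positive on [1, t] and its Wronskian at t positive as well.\<close>
      define e where "e = min (X c s) (W c / (\<bar>p t\<bar> + \<bar>q t\<bar>))"
      have pq: "0 < \<bar>p t\<bar> + \<bar>q t\<bar>" using p_pos[OF t] by simp
      have e: "0 < e" using pos[of s] s(1) pq \<open>\<not> W c \<le> 0\<close> by (auto simp: e_def)
      obtain d where d: "0 < d"
        and d_close: "\<And>c' r. \<bar>c' - c\<bar> < d \<Longrightarrow> r \<in> {0..t} \<Longrightarrow> \<bar>X c' r - X c r\<bar> < e \<and> \<bar>Z c' r - Z c r\<bar> < e"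
        using shooting_continuous[OF sys X0 Z0, of t e c] t e by auto
      obtain c' where c': "c' \<in> N" and "\<bar>c' - c\<bar> < d" using near[OF d] by blast
      note close = d_close[OF this(2)]
      have pos': "0 < X c' r" if "r \<in> {1..t}" for r
        using close[of r] s(2)[OF that] that by (auto simp: e_def abs_if split: if_splits)
      have pos01: "0 < X c' r" if "0 < r" "r \<le> 1" for r
        using positive_if_positive_at_1[OF sys X0 pos'[of 1]] that t by auto
      have sys1: "sl_system a b G 1 (X c') (Z c')" by (rule sl_system_later[OF sys]) simp
      obtain u where u: "0 < u" "X c' u \<le> 0" using c' by (auto simp: N_def)
      have "1 \<le> u" using pos01[of u] u by force
      then obtain T where T: "1 < T" "X c' T = 0" "\<And>r. 1 \<le> r \<Longrightarrow> r < T \<Longrightarrow> 0 < X c' r"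
        using first_zero[OF sl_system_continuous(1)[OF sys1], of u] pos'[of 1] u t by auto
      have "t < T" using pos'[of T] T by force
      have "W c' \<le> 0"
        unfolding W_def
        by (rule wronskian_nonpos_before_zero[OF sys1 p _ p_pos B_nonneg b_le _ T(1,2)])
          (use a_pos G_nonneg G_le T t \<open>t < T\<close> in \<open>auto intro: less_imp_le\<close>)
      have "W c - W c' = (X c' t - X c t) * q t - (Z c' t - Z c t) * p t"
        by (simp add: W_def algebra_simps)
      also have "\<dots> \<le> \<bar>X c' t - X c t\<bar> * \<bar>q t\<bar> + \<bar>Z c' t - Z c t\<bar> * \<bar>p t\<bar>"
        using abs_triangle_ineq4[of "(X c' t - X c t) * q t" "(Z c' t - Z c t) * p t"]
        by (simp add: abs_mult)
      also have "\<dots> < e * \<bar>q t\<bar> + e * \<bar>p t\<bar>"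
        using close[of t] t p_pos[OF t]
        by (intro add_le_less_mono mult_strict_right_mono mult_right_mono) auto
      also have "\<dots> = e * (\<bar>p t\<bar> + \<bar>q t\<bar>)" by (simp add: algebra_simps)
      also have "\<dots> \<le> W c / (\<bar>p t\<bar> + \<bar>q t\<bar>) * (\<bar>p t\<bar> + \<bar>q t\<bar>)"
        by (intro mult_right_mono) (auto simp: e_def)
      also have "\<dots> = W c" using pq by simp
      finally show False using \<open>W c' \<le> 0\<close> by simp
    qed
    then show "Z c t * p t - X c t * q t \<le> 0" by (simp add: W_def)
  qed
qed

end

section \<open>The boundary value problem\<close>

theorem theorem1:
  fixes a b F F' A :: "real \<Rightarrow> real" and B k0 kinf t1 t2 :: real
  assumes a_cont: "continuous_on {0..} a"
    and a_pos: "\<And>t. 0 \<le> t \<Longrightarrow> 0 < a t"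
    and a_int: "(\<lambda>t. 1 / a t) integrable_on {0..}"
    and b_cont: "continuous_on {0..} b"
    and b_nonneg: "\<And>t. 0 \<le> t \<Longrightarrow> t \<le> 1 \<Longrightarrow> 0 \<le> b t"
    and b_nz: "\<exists>t\<in>{0..1}. b t \<noteq> 0"
    and B_pos: "0 < B"
    and b_le: "\<And>t. 1 \<le> t \<Longrightarrow> b t \<le> B"
    and F_cont: "continuous_on UNIV F"
    and F_sign: "\<And>u. u \<noteq> 0 \<Longrightarrow> 0 < F u * u"
    and F_deriv: "\<And>u. 0 \<le> u \<Longrightarrow> (F has_real_derivative F' u) (at u within {0..})"
    and F'_bounds: "\<And>u. 0 \<le> u \<Longrightarrow> 0 \<le> F' u \<and> F' u \<le> 1"
    and F_zero: "((\<lambda>u. F u / u) \<longlongrightarrow> k0) (at_right 0)"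
    and F_infinity: "((\<lambda>u. F u / u) \<longlongrightarrow> kinf) at_top"
    and k0_nonneg: "0 \<le> k0"
    and k_neq: "k0 \<noteq> kinf"
    and A_eq: "\<And>t. A t = integral {0..t} (\<lambda>s. 1 / a s)"
    and disconj: "disconjugate_on (\<lambda>t. 1) (\<lambda>t. B / a t) {1..}"
    and t12: "0 < t1" "t1 < t2" "t2 < 1"
    and b_int_pos: "0 < integral {t1..t2} b"
    and k_min: "0 \<le> min k0 kinf * A 1 * integral {0..1} (\<lambda>t. \<bar>b t\<bar>)"
      "min k0 kinf * A 1 * integral {0..1} (\<lambda>t. \<bar>b t\<bar>) < 1"
    and k_max: "max k0 kinf * integral {t1..t2} b > A 1 / (A t1 * (A 1 - A t2))"
  shows "\<exists>x. solution_on a b F {0..} x \<and>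
    x 0 = 0 \<and> (\<forall>t>0. 0 < x t) \<and> (x \<longlongrightarrow> 0) at_top \<and>
    (\<exists>\<tau>\<in>{0<..1}. \<forall>\<^sub>F t in nhds \<tau>. x t \<le> x \<tau>) \<and>
    (\<forall>s t. 1 \<le> s \<and> s < t \<longrightarrow> x t < x s) \<and>
    (\<integral>\<^sup>+t\<in>{1..}. ennreal (1 / (a t * (x t)\<^sup>2)) \<partial>lborel) = \<infinity>"
proof -
  define G where "G = (\<lambda>u. F (max u 0))"
  define \<beta> where "\<beta> = integral {0..1} b"

  have "((\<lambda>u. F u / u * u) \<longlongrightarrow> k0 * 0) (at_right 0)"
    by (intro tendsto_mult F_zero tendsto_ident_at)
  moreover have "((\<lambda>u. F u / u * u) \<longlongrightarrow> F 0) (at_right 0)"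
  proof (rule Lim_transform_eventually)
    show "(F \<longlongrightarrow> F 0) (at_right 0)"
      using F_cont by (auto simp: continuous_on_def intro: tendsto_within_subset)
    show "\<forall>\<^sub>F u in at_right 0. F u = F u / u * u"
      using eventually_at_right_less by eventually_elim auto
  qed
  ultimately have F_0: "F 0 = 0" using tendsto_unique[of "at_right (0 :: real)"] by fastforce
  have F_mono: "F u \<le> F v" if "0 \<le> u" "u \<le> v" for u v
    by (rule half_line_derivative_nondecreasing[OF F_deriv]) (use that F'_bounds in auto)
  have F_lip: "F v - F u \<le> v - u" if "0 \<le> u" "u \<le> v" for u v
  proof -
    have "((\<lambda>u. u - F u) has_real_derivative 1 - F' u) (at u within {0..})" if "0 \<le> u" for u
      by (auto intro!: derivative_eq_intros F_deriv that)
    from half_line_derivative_nondecreasing[OF this that] have "u - F u \<le> v - F v"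
      using that F'_bounds by fastforce
    then show ?thesis by simp
  qed
  have G_mono: "G u \<le> G v" if "u \<le> v" for u v
    unfolding G_def using that by (intro F_mono) auto
  have G_lip: "\<bar>G u - G v\<bar> \<le> \<bar>u - v\<bar>" for u v
  proof -
    have *: "\<bar>G u - G v\<bar> \<le> \<bar>u - v\<bar>" if "u \<le> v" for u v
      using F_lip[of "max u 0" "max v 0"] G_mono[OF that] that by (auto simp: G_def max_def split: if_splits)
    show ?thesis using *[of u v] *[of v u] by (cases "u \<le> v") (auto simp: abs_minus_commute)
  qed
  have A_deriv: "(A has_real_derivative 1 / a t) (at t within {0..})" if "0 \<le> t" for t
  proof -
    have "continuous_on {0..} (\<lambda>t. 1 / a t)"
      by (intro continuous_intros a_cont) (auto dest: a_pos)
    then show ?thesis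
      unfolding has_real_derivative_iff_has_vector_derivative A_eq
      by (rule integral_has_vector_derivative_atLeast[OF _ that])
  qed
  interpret shooting a b G A B
  proof
    show "G 0 = 0" by (simp add: G_def F_0)
    show "0 \<le> G u" for u using F_mono[of 0 "max u 0"] F_0 by (simp add: G_def)
    show "A 0 = 0" by (simp add: A_eq)
  qed (use a_cont a_pos b_cont b_nonneg b_le B_pos A_deriv G_lip G_mono in auto)

  have A1: "0 < A t1" "A t1 < A t2" "A t2 < A 1" and A1_pos: "0 < A 1"
    using A_pos[of t1] A_pos[of 1] A_increasing[of t1 t2] A_increasing[of t2 1] t12 by auto
  have \<beta>: "0 \<le> \<beta>" unfolding \<beta>_def
    by (intro integral_nonneg integrable_continuous_real continuous_on_subset[OF b_cont]) (use b_nonneg in auto)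
  have "integral {0..1} (\<lambda>t. \<bar>b t\<bar>) = \<beta>"
    unfolding \<beta>_def by (rule integral_cong) (use b_nonneg in auto)
  then have k_min': "min k0 kinf * (A 1 * \<beta>) < 1" using k_min(2) by (simp add: mult.assoc)

  obtain y w where y: "sl_system a (\<lambda>_. B) (\<lambda>u. u) 1 y w" "y 1 = 1" "w 1 = 0"
    "\<And>t. 1 \<le> t \<Longrightarrow> 0 < y t" and w_neg: "\<And>t. 1 < t \<Longrightarrow> w t < 0"
    by (rule disconjugate_positive_reciprocal[OF _ _ B_pos disconj])
      (use a_pos in \<open>auto intro: continuous_on_subset[OF a_cont]\<close>)

  \<comment> \<open>A slope that works: u is close to 0 or to infinity, wherever the quotient F(u)/u is small.\<close>
  have "\<exists>u>0. F u / u * (A 1 * \<beta>) < 1"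
  proof (cases "k0 < kinf")
    case True
    have "((\<lambda>u. F u / u * (A 1 * \<beta>)) \<longlongrightarrow> k0 * (A 1 * \<beta>)) (at_right 0)"
      by (intro tendsto_intros F_zero)
    then have "\<forall>\<^sub>F u in at_right 0. F u / u * (A 1 * \<beta>) < 1"
      by (rule order_tendstoD(2)) (use k_min' True in simp)
    then have "\<forall>\<^sub>F u in at_right 0. 0 < u \<and> F u / u * (A 1 * \<beta>) < 1"
      using eventually_at_right_less by eventually_elim auto
    from eventually_happens'[OF _ this] show ?thesis by simp
  next
    case False
    have "((\<lambda>u. F u / u * (A 1 * \<beta>)) \<longlongrightarrow> kinf * (A 1 * \<beta>)) at_top"
      by (intro tendsto_intros F_infinity)
    then have "\<forall>\<^sub>F u in at_top. F u / u * (A 1 * \<beta>) < 1"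
      by (rule order_tendstoD(2)) (use k_min' False in simp)
    then have "\<forall>\<^sub>F u in at_top. 0 < u \<and> F u / u * (A 1 * \<beta>) < 1"
      using eventually_gt_at_top[of 0] by eventually_elim auto
    from eventually_happens'[OF _ this] show ?thesis by simp
  qed
  then obtain u where u: "0 < u" "F u / u * (A 1 * \<beta>) < 1" by blast
  have lo: "0 < x t" if "sl_system a b G 0 x z" "x 0 = 0" "z 0 = u / A 1" "0 < t" for x z t
  proof (rule positive_after_increasing_phase[OF that(1,2) _ y that(4)])
    have "F u * \<beta> < u / A 1" using u A1_pos by (simp add: field_simps)
    then show "G (z 0 * A 1) * integral {0..1} b < z 0"
      using that(3) A1_pos u(1) by (simp add: G_def \<beta>_def)
  qed

  define I where "I = integral {t1..t2} b"
  define C where "C = A 1 / (A t1 * (A 1 - A t2))"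
  define E where "E = A 1 - A t1 + A 1 * A t1 * \<beta>"
  have E: "0 < E" using A1 A1_pos \<beta> by (auto simp: E_def intro!: add_pos_nonneg)
  have small: "\<exists>\<mu>. 0 < \<mu> \<and> \<mu> \<le> \<alpha> * A 1 \<and> \<alpha> * (A t1 * (A 1 - A t2)) \<le> \<mu> * E \<and> F \<mu> / \<mu> * I < C"
    if x: "sl_system a b G 0 x z" "x 0 = 0" "z 0 = \<alpha>" and pos: "\<And>t. 0 < t \<Longrightarrow> 0 < x t" and "0 < \<alpha>" for x z \<alpha>
  proof (intro exI conjI)
    define \<mu> where "\<mu> = min (x t1) (x t2)"
    show mu: "0 < min (x t1) (x t2)" using pos t12 by simp
    have "x t1 \<le> \<alpha> * A t1" using below_initial_ray[OF x(1,2), of t1] t12 x(3) by simp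
    also have "\<dots> \<le> \<alpha> * A 1" using A1 \<open>0 < \<alpha>\<close> by (intro mult_left_mono) auto
    finally show "min (x t1) (x t2) \<le> \<alpha> * A 1" by simp
    show "\<alpha> * (A t1 * (A 1 - A t2)) \<le> min (x t1) (x t2) * E"
      using values_comparable_to_slope[OF x(1,2) t12 pos[of 1]] x(3) by (simp add: E_def \<beta>_def)
    have "F \<mu> * I * (A t1 * (A 1 - A t2)) < \<mu> * A 1"
      using green_bound[OF x(1,2) t12 pos[of 1]] mu by (simp add: G_def I_def \<mu>_def)
    then show "F (min (x t1) (x t2)) / min (x t1) (x t2) * I < C"
      using mu A1 unfolding C_def \<mu>_def[symmetric] by (simp add: field_simps)
  qed
  have k_max': "C < max k0 kinf * I" using k_max by (simp add: C_def I_def)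
  \<comment> \<open>A slope that fails: both bounds on \<mu> scale with \<alpha>, which pushes \<mu> to where F(\<mu>)/\<mu> is large.\<close>
  have "\<exists>\<alpha>>0. \<forall>\<mu>. 0 < \<mu> \<and> \<mu> \<le> \<alpha> * A 1 \<and> \<alpha> * (A t1 * (A 1 - A t2)) \<le> \<mu> * E \<longrightarrow> C < F \<mu> / \<mu> * I"
  proof (cases "k0 < kinf")
    case True
    have "((\<lambda>u. F u / u * I) \<longlongrightarrow> kinf * I) at_top"
      by (intro tendsto_intros F_infinity)
    then have "\<forall>\<^sub>F u in at_top. C < F u / u * I"
      by (rule order_tendstoD(1)) (use k_max' True in simp)
    then obtain R where R: "\<And>u. R \<le> u \<Longrightarrow> C < F u / u * I" by (auto simp: eventually_at_top_linorder)
    define \<alpha> where "\<alpha> = max R 1 * E / (A t1 * (A 1 - A t2))"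
    have "0 < \<alpha>" using A1 E by (simp add: \<alpha>_def)
    moreover have "C < F \<mu> / \<mu> * I" if "\<alpha> * (A t1 * (A 1 - A t2)) \<le> \<mu> * E" for \<mu>
    proof (rule R)
      have "max R 1 * E \<le> \<mu> * E" using that A1 by (simp add: \<alpha>_def)
      then show "R \<le> \<mu>" using E by simp
    qed
    ultimately show ?thesis by blast
  next
    case False
    have "((\<lambda>u. F u / u * I) \<longlongrightarrow> k0 * I) (at_right 0)"
      by (intro tendsto_intros F_zero)
    then have "\<forall>\<^sub>F u in at_right 0. C < F u / u * I"
      by (rule order_tendstoD(1)) (use k_max' False in simp)
    then obtain d where d: "0 < d" "\<And>u. 0 < u \<Longrightarrow> u < d \<Longrightarrow> C < F u / u * I"
      by (auto simp: eventually_at_right_field)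
    have "C < F \<mu> / \<mu> * I" if "0 < \<mu>" "\<mu> \<le> d / (2 * A 1) * A 1" for \<mu>
      using d(2)[of \<mu>] that d(1) A1_pos by simp
    then show ?thesis using d(1) A1_pos by (intro exI[of _ "d / (2 * A 1)"]) auto
  qed
  then obtain \<alpha> where \<alpha>: "0 < \<alpha>"
    and large: "\<And>\<mu>. 0 < \<mu> \<Longrightarrow> \<mu> \<le> \<alpha> * A 1 \<Longrightarrow> \<alpha> * (A t1 * (A 1 - A t2)) \<le> \<mu> * E \<Longrightarrow> C < F \<mu> / \<mu> * I"
    by blast
  have hi: "\<exists>t>0. x t \<le> 0" if x: "sl_system a b G 0 x z" "x 0 = 0" "z 0 = \<alpha>" for x z
  proof (rule ccontr)
    assume "\<not> ?thesis"
    then have "\<And>t. 0 < t \<Longrightarrow> 0 < x t" by force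
    from small[OF x this \<alpha>] large show False by (meson less_asym)
  qed

  have "0 < u / A 1" using u(1) A1_pos by simp
  obtain x z where sys: "sl_system a b G 0 x z" and x_0: "x 0 = 0" and x_pos: "\<And>t. 0 < t \<Longrightarrow> 0 < x t"
    and W: "\<And>p q t. sl_system a (\<lambda>_. B) (\<lambda>u. u) 1 p q \<Longrightarrow> \<forall>t\<ge>1. 0 < p t \<Longrightarrow> 1 \<le> t \<Longrightarrow>
      z t * p t - x t * q t \<le> 0"
  proof (rule critical_solution[OF \<open>0 < u / A 1\<close> _ \<alpha>])
    show "0 < x t" if "sl_system a b G 0 x z" "x 0 = 0" "z 0 = u / A 1" "0 < t" for x z t
      by (rule lo[OF that])
    show "\<exists>t>0. x t \<le> 0" if "sl_system a b G 0 x z" "x 0 = 0" "z 0 = \<alpha>" for x z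
      by (rule hi[OF that])
  qed (rule that)
  have x_nonneg: "0 \<le> x t" if "0 \<le> t" for t using x_pos[of t] x_0 that by (cases "t = 0") auto
  \<comment> \<open>The flux of x is compared with that of y, which is negative after 1.\<close>
  have z_neg: "z t < 0" if t: "1 < t" for t
  proof -
    have "z t * y t \<le> x t * w t" using W[OF y(1), of t] y(4) t by simp
    also have "\<dots> < 0" using x_pos[of t] w_neg[of t] t by (simp add: mult_pos_neg)
    finally show ?thesis using y(4)[of t] t by (simp add: mult_less_0_iff)
  qed
  have decr: "x t < x s" if st: "1 \<le> s" "s < t" for s t
  proof -
    have D: "((\<lambda>t. - x t) has_real_derivative - (z t / a t)) (at t within {0..})" if "0 \<le> t" for t
      by (intro DERIV_minus sl_systemD[OF sys] that)
    have "- x s < - x t"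
    proof (rule half_line_derivative_increasing[where f = "\<lambda>t. - x t", OF D])
      show "0 < - (z r / a r)" if "s < r" "r < t" for r
        using z_neg[of r] a_pos[of r] that st by (simp add: divide_neg_pos)
    qed (use st in auto)
    then show ?thesis by simp
  qed
  have principal: "(\<integral>\<^sup>+t\<in>{1..}. ennreal (1 / (a t * (x t)\<^sup>2)) \<partial>lborel) = \<infinity>"
  proof (rule principal_if_wronskians_nonpos[OF sl_system_later[OF sys] y(1)])
    show "z t * p t - x t * q t \<le> 0"
      if "sl_system a (\<lambda>_. B) (\<lambda>u. u) 1 p q" "\<forall>t\<ge>1. 0 < p t" "1 \<le> t" for p q t
      by (rule W[OF that])
  qed (use a_pos x_pos y(4) in \<open>auto intro: continuous_on_subset[OF a_cont]\<close>)
  have "(\<lambda>t. 1 / a t) absolutely_integrable_on {0..}"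
    by (rule nonnegative_absolutely_integrable_1[OF a_int]) (use a_pos in \<open>auto simp: less_imp_le\<close>)
  then have "(\<lambda>t. 1 / a t) absolutely_integrable_on {1..}"
    by (rule set_integrable_subset) auto
  then have a_int1: "(\<lambda>t. 1 / a t) integrable_on {1..}"
    by (rule set_lebesgue_integral_eq_integral(1))
  have lim: "(x \<longlongrightarrow> 0) at_top"
    by (rule decreasing_principal_tendsto_0[OF _ a_int1 _ decr principal]) (use a_pos x_pos in auto)
  have solution: "solution_on a b F {0..} x"
    unfolding solution_on_def
  proof (rule exI[of _ "\<lambda>t. z t / a t"], rule exI[of _ "\<lambda>t. - b t * G (x t)"], intro conjI ballI)
    fix t :: real assume t: "t \<in> {0..}"
    show "(x has_real_derivative z t / a t) (at t within {0..})"
      using sl_systemD(1)[OF sys] t by simp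
    have "(z has_real_derivative - b t * G (x t)) (at t within {0..})"
      using sl_systemD(2)[OF sys] t by simp
    then show "((\<lambda>s. a s * (z s / a s)) has_real_derivative - b t * G (x t)) (at t within {0..})"
      by (rule has_field_derivative_transform_within[where d = 1]) (use t in \<open>auto dest: a_pos\<close>)
    show "- b t * G (x t) + b t * F (x t) = 0" using x_nonneg[of t] t by (simp add: G_def)
  next
    show "continuous_on {0..} (\<lambda>t. z t / a t)"
      by (intro continuous_intros a_cont sl_system_continuous[OF sys]) (auto dest: a_pos)
    show "continuous_on {0..} (\<lambda>t. - b t * G (x t))"
      by (intro continuous_intros b_cont continuous_on_compose2[OF G_cont sl_system_continuous(1)[OF sys]])
        auto
  qed
  have local_max: "\<exists>\<tau>\<in>{0<..1}. \<forall>\<^sub>F t in nhds \<tau>. x t \<le> x \<tau>"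
  proof -
    have "continuous_on {0..1} x"
      by (rule continuous_on_subset[OF sl_system_continuous(1)[OF sys]]) auto
    then obtain \<tau> where \<tau>: "\<tau> \<in> {0..1}" "\<And>t. t \<in> {0..1} \<Longrightarrow> x t \<le> x \<tau>"
      using continuous_attains_sup[of "{0..1}" x] by auto
    have "0 < x \<tau>" using \<tau>(2)[of 1] x_pos[of 1] by simp
    then have "0 < \<tau>" using \<tau>(1) x_0 by (cases "\<tau> = 0") auto
    \<comment> \<open>The maximum over [0, 1] is one over (0, \<infinity>), so it is a local maximum even if it lies at 1.\<close>
    have "x t \<le> x \<tau>" if "0 < t" for t
      using \<tau>(2)[of t] \<tau>(2)[of 1] decr[of 1 t] that by (cases "t \<le> 1") auto
    then have "\<forall>\<^sub>F t in nhds \<tau>. x t \<le> x \<tau>"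
      using eventually_nhds_in_open[of "{0<..}" \<tau>] \<open>0 < \<tau>\<close> by (auto elim: eventually_mono)
    then show ?thesis using \<tau>(1) \<open>0 < \<tau>\<close> by (intro bexI[of _ \<tau>]) auto
  qed
  show ?thesis
    using solution x_0 x_pos lim local_max decr principal by blast
qed

end
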